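(* Let $A\in\mathbb{R}^{n\times n}$, $B\in\mathbb{R}^{n\times m}$, $C\in\mathbb{R}^{q\times n}$, let $\Phi:[0,\infty)\times\mathbb{R}^q\to\mathbb{R}^m$ be continuously differentiable with Jacobian $J_\Phi(t,y):=\frac{\partial\Phi}{\partial y}(t,y)\in\mathbb{R}^{m\times q}$, and consider the Lurie system $$\dot x(t)=Ax(t)-B\Phi(t,Cx(t)),\qquad x(t)\in\mathbb{R}^n,$$ whose Jacobian is $J(t,x):=A-BJ_\Phi(t,Cx)C$. Fix an integer $k\in\{1,\dots,n\}$. Suppose that there exist $\eta_1,\eta_2\in\mathbb{R}$ and $P\in\mathbb{R}^{n\times n}$, where $P=QQ$ with $Q\in\mathbb{R}^{n\times n}$ symmetric positive definite, such that $$P^{(k)}A^{[k]}+(A^{[k]})^TP^{(k)}+\eta_1P^{(k)}+Q^{(k)}\left((QBB^TQ)^{[k]}+(Q^{-1}C^TCQ^{-1})^{[k]}\right)Q^{(k)}\preceq 0,$$ and, furthermore, at least one of the following two conditions holds: (i) $\displaystyle\sum_{i=1}^k\lambda_i\left(Q^{-1}C^T\left(J_\Phi^T(t,y)J_\Phi(t,y)-I_q\right)CQ^{-1}\right)\le-\eta_2$ for all $t\ge0$, $y\in\mathbb{R}^q$; or (ii) $\displaystyle\sum_{i=1}^k\lambda_i\left(QB\left(J_\Phi(t,y)J_\Phi^T(t,y)-I_m\right)B^TQ\right)\le-\eta_2$ for all $t\ge0$, $y\in\mathbb{R}^q$. Then $$\mu_{2,Q^{(k)}}\left(J(t,x)^{[k]}\right)\le-(\eta_1+\eta_2)/2\quad\text{for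 all }t\ge0,\ x\in\mathbb{R}^n.$$ In particular, if $\eta_1+\eta_2>0$, then the Lurie system is $k$-contractive with rate $(\eta_1+\eta_2)/2$ with respect to the scaled $L_2$ norm $|z|_{2,Q^{(k)}}=|Q^{(k)}z|_2$.
   Context: For $M\in\mathbb{R}^{n\times m}$ and $1\le k\le\min\{n,m\}$, the $k$-multiplicative compound $M^{(k)}$ is the $\binom nk\times\binom mk$ matrix of all $k\times k$ minors of $M$, with row and column index sets ordered lexicographically. For $A\in\mathbb{R}^{n\times n}$, the $k$-additive compound is $A^{[k]}:=\frac{d}{d\varepsilon}(I_n+\varepsilon A)^{(k)}\big|_{\varepsilon=0}\in\mathbb{R}^{\binom nk\times\binom nk}$. For symmetric $S\in\mathbb{R}^{n\times n}$, $\lambda_1(S)\ge\dots\ge\lambda_n(S)$ are its ordered eigenvalues, and $S\preceq0$ means $S$ is negative semidefinite. For an invertible matrix $H$, $|x|_{2,H}:=|Hx|_2$, and the induced matrix measure is $\mu_{2,H}(M)=\frac12\lambda_{\max}\left(HMH^{-1}+(HMH^{-1})^T\right)$. A system $\dot x=f(t,x)$ on a state space $\Omega\subseteq\mathbb{R}^n$, with Jacobian $J(t,x)=\frac{\partial f}{\partial x}(t,x)$, is $k$-contractive with rate $\eta>0$ with respect to a norm $|\cdot|$ on $\mathbb{R}^{\binom nk}$ if for every solution $x:[s,T]\to\Omega$ ($0\le s<T$) and all solutions $\delta^1,\dots,\delta^k:[s,T]\to\mathbb{R}^n$ of the variational equation $\dot\delta(t)=J(t,x(t))\delta(t)$, the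 matrix $X(t):=[\delta^1(t)\ \cdots\ \delta^k(t)]\in\mathbb{R}^{n\times k}$ satisfies $|X(t)^{(k)}|\le e^{-\eta(t-s)}|X(s)^{(k)}|$ for all $t\in[s,T]$. *)

theory Defs
  imports
    "HOL-Analysis.Analysis"
    "HOL-Library.Sublist"
    "Jordan_Normal_Form.Char_Poly"
    "Jordan_Normal_Form.Gauss_Jordan_Elimination"
    "Jordan_Normal_Form.DL_Submatrix"
begin

text \<open>
  Vectors and matrices of the fixed sizes \<open>n\<close>, \<open>m\<close>, \<open>q\<close> are those of HOL-Analysis (\<^typ>\<open>real ^ 'n\<close>,
  \<^typ>\<open>real ^ 'm ^ 'n\<close>). Compounds have sizes \<open>n choose k\<close> that depend on the number \<open>k\<close>, so they live
  in the matrices with explicit dimensions of Jordan_Normal_Form, whose entries are numbered from 0.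
\<close>

no_notation Matrix.vec_index (infixl "$" 100)
no_notation Matrix.scalar_prod (infix "\<bullet>" 70)
hide_const (open) Matrix.vec Matrix.mat Matrix.row Determinant.det

text \<open>The linear order on the index type fixes the numbering of rows and columns, and hence the
  lexicographic order on \<open>k\<close>-subsets. Types with these classes exist for every size \<open>n \<ge> 1\<close>.\<close>

definition idx :: "nat \<Rightarrow> 'n::{finite,linorder}" where
  "idx i = sorted_list_of_set (UNIV :: 'n set) ! i"

definition to_mat :: "'a ^ 'm::{finite,linorder} ^ 'n::{finite,linorder} \<Rightarrow> 'a Matrix.mat" where
  "to_mat M = Matrix.mat CARD('n) CARD('m) (\<lambda>(i, j). M $ idx i $ idx j)"

definition cols_to_mat ::
  "nat \<Rightarrow> (nat \<Rightarrow> 'a ^ 'n::{finite,linorder}) \<Rightarrow> 'a Matrix.mat" where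
  "cols_to_mat k d = Matrix.mat CARD('n) k (\<lambda>(i, j). d j $ idx i)"


text \<open>The increasing lists of \<open>k\<close> elements of \<open>{0..<n}\<close>; \<^const>\<open>subseqs\<close> produces them in
  lexicographic order, see \<open>k_subsets_sorted\<close>.\<close>

definition k_subsets :: "nat \<Rightarrow> nat \<Rightarrow> nat list list" where
  "k_subsets n k = filter (\<lambda>I. length I = k) (subseqs [0..<n])"

lemma set_k_subsets: "set (k_subsets n k) = {I. sorted_wrt (<) I \<and> set I \<subseteq> {0..<n} \<and> length I = k}"
proof -
  have "subseq I [0..<n] \<longleftrightarrow> sorted_wrt (<) I \<and> set I \<subseteq> {0..<n}" for I
  proof
    assume "subseq I [0..<n]"
    then obtain N where N: "I = nths [0..<n] N" by (auto simp: subseq_conv_nths)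
    then have "sorted I" "distinct I" by (auto intro: sorted_nths)
    moreover have "set I \<subseteq> {0..<n}" unfolding N using set_nths_subset by fastforce
    ultimately show "sorted_wrt (<) I \<and> set I \<subseteq> {0..<n}" by (simp add: strict_sorted_iff)
  next
    assume "sorted_wrt (<) I \<and> set I \<subseteq> {0..<n}"
    then show "subseq I [0..<n]" by (intro sorted_subset_imp_subseq) auto
  qed
  then show ?thesis by (auto simp: k_subsets_def)
qed

lemma k_subsets_sorted: "sorted_wrt (\<lambda>I J. (I, J) \<in> lexord {(i, j). i < j}) (k_subsets n k)"
proof -
  define R where "R = (\<lambda>k I J. length I = k \<longrightarrow> length J = k \<longrightarrow> (I, J) \<in> lexord {(i, j :: nat). i < j})"
  have gen: "sorted_wrt (<) xs \<Longrightarrow> sorted_wrt (R k) (subseqs xs)" for k and xs :: "nat list"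
  proof (induction xs arbitrary: k)
    case Nil
    then show ?case by simp
  next
    case (Cons x xs)
    have map: "sorted_wrt (R k) (map (Cons x) (subseqs xs))"
    proof (cases k)
      case 0
      then show ?thesis by (simp add: sorted_wrt_map R_def sorted_wrt_iff_nth_less)
    next
      case (Suc k')
      have "sorted_wrt (R k') (subseqs xs)" using Cons by simp
      then show ?thesis unfolding sorted_wrt_map
        by (rule sorted_wrt_mono_rel[rotated]) (auto simp: R_def Suc)
    qed
    have "R k (x # I) J" if "J \<in> set (subseqs xs)" for I J
    proof (cases J)
      case Nil
      then show ?thesis by (auto simp: R_def)
    next
      case (Cons y ys)
      have "subseq J xs" using that by simp
      then have "y \<in> set xs" using Cons by (metis list.set_intros(1) set_nths_subset subseq_conv_nths subsetD)
      then show ?thesis using Cons.prems Cons by (auto simp: R_def)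
    qed
    then show ?case using map Cons by (auto simp: Let_def sorted_wrt_append)
  qed
  show ?thesis
    unfolding k_subsets_def
    using sorted_wrt_filter[OF gen[of "[0..<n]" k], of "\<lambda>I. length I = k"]
    by (rule sorted_wrt_mono_rel[rotated]) (auto simp: R_def)
qed

definition compound :: "nat \<Rightarrow> 'a::comm_ring_1 Matrix.mat \<Rightarrow> 'a Matrix.mat" where
  "compound k M =
     Matrix.mat (dim_row M choose k) (dim_col M choose k)
       (\<lambda>(i, j). Determinant.det
          (submatrix M (set (k_subsets (dim_row M) k ! i)) (set (k_subsets (dim_col M) k ! j))))"

definition add_compound :: "nat \<Rightarrow> real Matrix.mat \<Rightarrow> real Matrix.mat" where
  "add_compound k A =
     (let n = dim_row A in
      Matrix.mat (n choose k) (n choose k)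
        (\<lambda>(i, j). deriv (\<lambda>\<epsilon>. compound k (1\<^sub>m n + \<epsilon> \<cdot>\<^sub>m A) $$ (i, j)) 0))"


text \<open>For symmetric \<open>S\<close> the real roots of the characteristic polynomial, with multiplicity, are all
  the eigenvalues; \<open>i\<close> is counted from 1.\<close>

definition ord_eigenvalue :: "real Matrix.mat \<Rightarrow> nat \<Rightarrow> real" where
  "ord_eigenvalue S i = rev (sorted_list_of_multiset (proots (char_poly S))) ! (i - 1)"

definition neg_semidef :: "real Matrix.mat \<Rightarrow> bool" where
  "neg_semidef S \<longleftrightarrow>
     S\<^sup>T = S \<and> (\<forall>v \<in> carrier_vec (dim_row S). scalar_prod v (S *\<^sub>v v) \<le> 0)"

definition sym_pos_def :: "real ^ 'n ^ 'n \<Rightarrow> bool" where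
  "sym_pos_def Q \<longleftrightarrow> transpose Q = Q \<and> (\<forall>v. v \<noteq> 0 \<longrightarrow> v \<bullet> (Q *v v) > 0)"

definition norm2 :: "real Matrix.vec \<Rightarrow> real" where
  "norm2 v = sqrt (scalar_prod v v)"

definition scaled_norm2 :: "real Matrix.mat \<Rightarrow> real Matrix.vec \<Rightarrow> real" where
  "scaled_norm2 H v = norm2 (H *\<^sub>v v)"

definition matrix_measure2 :: "real Matrix.mat \<Rightarrow> real Matrix.mat \<Rightarrow> real" where
  "matrix_measure2 H M =
     (let N = H * M * the (mat_inverse H) in ord_eigenvalue (N + N\<^sup>T) 1 / 2)"


definition C1_on :: "'a::real_normed_vector set \<Rightarrow> ('a \<Rightarrow> 'b::real_normed_vector) \<Rightarrow> bool" where
  "C1_on S g \<longleftrightarrow>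
     (\<exists>g'. (\<forall>z\<in>S. (g has_derivative blinfun_apply (g' z)) (at z within S)) \<and> continuous_on S g')"

definition solution_on ::
  "(real \<Rightarrow> real ^ 'n \<Rightarrow> real ^ 'n) \<Rightarrow> (real ^ 'n) set \<Rightarrow> real \<Rightarrow> real \<Rightarrow> (real \<Rightarrow> real ^ 'n) \<Rightarrow> bool" where
  "solution_on f \<Omega> s T x \<longleftrightarrow>
     (\<forall>t\<in>{s..T}. x t \<in> \<Omega> \<and> (x has_vector_derivative f t (x t)) (at t within {s..T}))"

text \<open>\<open>X t\<close> is \<open>n \<times> k\<close>, so its compound has a single column, which is read as a vector.\<close>

definition k_contractive ::
  "nat \<Rightarrow> real \<Rightarrow> (real Matrix.vec \<Rightarrow> real) \<Rightarrow> (real ^ 'n::{finite,linorder}) set \<Rightarrow>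
   (real \<Rightarrow> real ^ 'n::{finite,linorder} \<Rightarrow> real ^ 'n::{finite,linorder}) \<Rightarrow> bool" where
  "k_contractive k \<eta> N \<Omega> f \<longleftrightarrow>
     \<eta> > 0 \<and>
     (\<forall>s T x \<delta>. 0 \<le> s \<longrightarrow> s < T \<longrightarrow> solution_on f \<Omega> s T x \<longrightarrow>
        (\<forall>j<k. solution_on (\<lambda>t v. jacobian (f t) (at (x t) within \<Omega>) *v v) UNIV s T (\<delta> j)) \<longrightarrow>
        (let X = (\<lambda>t. cols_to_mat k (\<lambda>j. \<delta> j t))
         in \<forall>t\<in>{s..T}. N (col (compound k (X t)) 0) \<le> exp (- \<eta> * (t - s)) * N (col (compound k (X s)) 0)))"

definition lurie ::
  "real ^ 'n ^ 'n \<Rightarrow> real ^ 'm ^ 'n \<Rightarrow> real ^ 'n ^ 'q \<Rightarrow> (real \<Rightarrow> real ^ 'q \<Rightarrow> real ^ 'm) \<Rightarrow>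
   real \<Rightarrow> real ^ 'n \<Rightarrow> real ^ 'n" where
  "lurie A B C \<Phi> t x = A *v x - B *v \<Phi> t (C *v x)"

definition lurie_jacobian ::
  "real ^ 'n ^ 'n \<Rightarrow> real ^ 'm ^ 'n \<Rightarrow> real ^ 'n ^ 'q \<Rightarrow> (real \<Rightarrow> real ^ 'q \<Rightarrow> real ^ 'm) \<Rightarrow>
   real \<Rightarrow> real ^ 'n \<Rightarrow> real ^ 'n ^ 'n" where
  "lurie_jacobian A B C \<Phi> t x = A - B ** jacobian (\<Phi> t) (at (C *v x)) ** C"

end

theory Submission
  imports Defs
begin

text \<open>
  Scaling by \<open>Q\<^sup>(\<^sup>k\<^sup>)\<close> turns \<open>J\<^sup>[\<^sup>k\<^sup>]\<close> into \<open>(Q J Q\<^sup>-\<^sup>1)\<^sup>[\<^sup>k\<^sup>]\<close>, by multiplicativity of compounds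
  (Cauchy--Binet), and \<open>Q J Q\<^sup>-\<^sup>1 = Q A Q\<^sup>-\<^sup>1 - U V\<close> with \<open>U V = Q B J\<^sub>\<Phi> C Q\<^sup>-\<^sup>1\<close>. Completing the square
  bounds the symmetric part of \<open>- U V\<close> by \<open>U U\<^sup>T + V\<^sup>T V\<close>, and putting \<open>J\<^sub>\<Phi>\<close> into \<open>V\<close> (condition (i)) or
  into \<open>U\<close> (condition (ii)) makes this sum the term of the linear matrix inequality plus the matrix
  of the condition. Additive compounds are linear, and by diagonalization the largest eigenvalue
  of \<open>S\<^sup>[\<^sup>k\<^sup>]\<close> is the sum of the \<open>k\<close> largest eigenvalues of a symmetric \<open>S\<close>. Contractivity follows
  since \<open>X\<^sup>(\<^sup>k\<^sup>)\<close> solves the linear equation with matrix \<open>J\<^sup>[\<^sup>k\<^sup>]\<close>, by Gronwall's inequality.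
\<close>

text \<open>The size \<open>n choose k\<close> is a number and not a type, which splits the spectral
  theory in two. Matrices of the fixed size n are diagonalized completely, by compactness of the
  unit sphere, and the result is carried over by \<open>to_mat\<close>. For matrices of compound
  size one spectral fact suffices: a symmetric matrix has a real eigenvalue, so
  \<open>ord_eigenvalue N 1\<close> is a genuine eigenvalue and a Rayleigh bound applies to it. The
  semidefinite order between compounds is likewise handled through numbers, the values
  \<open>quad_compound k w M\<close> of the form of M^[k], which are additive in M and blind to
  transposition. Both conclusions come from one inequality, 2 w^T (Q J Q^-1)^[k] w <= -(eta1 + eta2)
  w^T w. The matrix measure halves an eigenvalue of N + N^T, and Gronwall's inequality is applied to
  a squared norm; in both cases the halving produces the rate (eta1 + eta2)/2. Most laws of additive
  compounds are derivatives of laws of multiplicative ones: two expressions for one curve of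
  matrices have the same derivative at 0.\<close>

hide_const (open) Matrix.orthogonal

section \<open>Compounds and the Cauchy--Binet formula\<close>

text \<open>Exactly a elements of an increasing list lie below its entry at position a. This links
  \<open>submatrix\<close>, which selects by \<open>pick\<close> from a set, to plain list
  indexing.\<close>

lemma pick_set_sorted:
  assumes "sorted_wrt (<) I" "a < length I"
  shows "pick (set I) a = I ! a"
proof -
  have "distinct I" using assms(1) by (simp add: strict_sorted_iff)
  have "{x \<in> set I. x < I ! a} = (!) I ` {..<a}"
    using assms
    by (auto simp: in_set_conv_nth sorted_wrt_iff_nth_less image_iff)
      (metis lessThan_iff linorder_neqE_nat order_less_asym, metis order.strict_trans)
  then have "card {x \<in> set I. x < I ! a} = a"
    using \<open>distinct I\<close> assms(2) by (simp add: card_image inj_on_nth)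
  then show ?thesis using pick_card_in_set[of "I ! a" "set I"] assms(2) by auto
qed

lemma distinct_k_subsets: "distinct (k_subsets n k)"
  using distinct_set_subseqs[of "[0..<n]"] by (simp add: k_subsets_def distinct_map)

lemma length_k_subsets: "length (k_subsets n k) = n choose k"
proof -
  have "bij_betw set (set (k_subsets n k)) {S. S \<subseteq> {0..<n} \<and> card S = k}"
  proof (rule bij_betw_byWitness[where f' = sorted_list_of_set])
    show "set ` set (k_subsets n k) \<subseteq> {S. S \<subseteq> {0..<n} \<and> card S = k}"
      by (auto simp: set_k_subsets strict_sorted_iff distinct_card)
    show "sorted_list_of_set ` {S. S \<subseteq> {0..<n} \<and> card S = k} \<subseteq> set (k_subsets n k)"
      by (auto simp: set_k_subsets strict_sorted_iff dest: finite_subset)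
        (metis atLeastLessThan_iff finite_atLeastLessThan finite_subset set_sorted_list_of_set subsetD)
  qed (auto simp: set_k_subsets strict_sorted_iff sorted_list_of_set.idem_if_sorted_distinct
         dest: finite_subset)
  then have "card (set (k_subsets n k)) = n choose k"
    by (simp add: bij_betw_same_card n_subsets)
  then show ?thesis by (metis distinct_card distinct_k_subsets)
qed

lemma k_subsets_nth:
  assumes "i < n choose k"
  shows "k_subsets n k ! i \<in> set (k_subsets n k)"
  using assms by (simp add: length_k_subsets)

lemma k_subsetsD:
  assumes "I \<in> set (k_subsets n k)"
  shows "sorted_wrt (<) I" "distinct I" "length I = k" "\<And>a. a < k \<Longrightarrow> I ! a < n"
  using assms by (auto simp: set_k_subsets strict_sorted_iff subset_iff in_set_conv_nth)

lemma sum_k_subsets: "(\<Sum>i<n choose k. f (k_subsets n k ! i)) = (\<Sum>K\<in>set (k_subsets n k). f K)"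
  by (rule sum.reindex_bij_betw, rule bij_betw_nth)
    (auto simp: distinct_k_subsets length_k_subsets)

text \<open>Index lists instead of index sets: \<open>submatrix\<close> and \<open>pick\<close> then
  have to be unfolded only once, in \<open>compound_index\<close>.\<close>

definition minor :: "nat \<Rightarrow> 'a::comm_ring_1 Matrix.mat \<Rightarrow> nat list \<Rightarrow> nat list \<Rightarrow> 'a" where
  "minor k M I J = Determinant.det (Matrix.mat k k (\<lambda>(a, b). M $$ (I ! a, J ! b)))"

lemma compound_carrier [simp]:
  "M \<in> carrier_mat n m \<Longrightarrow> compound k M \<in> carrier_mat (n choose k) (m choose k)"
  by (auto simp: compound_def)

lemma dim_compound [simp]:
  "dim_row (compound k M) = dim_row M choose k" "dim_col (compound k M) = dim_col M choose k"
  by (simp_all add: compound_def)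

lemma compound_index:
  assumes "M \<in> carrier_mat n m" "i < n choose k" "j < m choose k"
  shows "compound k M $$ (i, j) = minor k M (k_subsets n k ! i) (k_subsets m k ! j)"
proof -
  have card: "card {x. x < N \<and> x \<in> set K} = k" if "K \<in> set (k_subsets N k)" for N K
  proof -
    have "{x. x < N \<and> x \<in> set K} = set K" using that by (auto simp: set_k_subsets)
    then show ?thesis using k_subsetsD[OF that] by (simp add: distinct_card)
  qed
  let ?I = "k_subsets n k ! i" and ?J = "k_subsets m k ! j"
  have "submatrix M (set ?I) (set ?J) = Matrix.mat k k (\<lambda>(a, b). M $$ (?I ! a, ?J ! b))"
    using assms card[OF k_subsets_nth[OF assms(2)]] card[OF k_subsets_nth[OF assms(3)]]
      k_subsetsD[OF k_subsets_nth[OF assms(2)]] k_subsetsD[OF k_subsets_nth[OF assms(3)]]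
    by (intro eq_matI) (auto simp: submatrix_def pick_set_sorted)
  then show ?thesis using assms by (simp add: compound_def minor_def)
qed

text \<open>An injective map h on {0..<k} is determined by its image, listed increasingly as K, and
  by the order p in which it runs through K. This regroups the sum over injective maps in the
  Cauchy-Binet formula. The \<open>restrict\<close> makes the composite extensional, as membership
  in the function space demands.\<close>

lemma bij_betw_k_subsets_permutations:
  "bij_betw (\<lambda>(K, p). restrict (\<lambda>a. K ! p a) {0..<k})
     (set (k_subsets n k) \<times> {p. p permutes {0..<k}})
     {h \<in> {0..<k} \<rightarrow>\<^sub>E {0..<n}. inj_on h {0..<k}}"
  unfolding bij_betw_def
proof (intro conjI)
  let ?F = "\<lambda>(K, p). restrict (\<lambda>a. K ! p a) {0..<k} :: nat \<Rightarrow> nat"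
  have img: "?F (K, p) ` {0..<k} = set K" if "K \<in> set (k_subsets n k)" "p permutes {0..<k}" for K p
  proof -
    have "?F (K, p) ` {0..<k} = (!) K ` p ` {0..<k}" by (auto simp: image_image)
    also have "\<dots> = (!) K ` {0..<k}" using that(2) by (simp add: permutes_image)
    also have "\<dots> = set K" using k_subsetsD(3)[OF that(1)] by (auto simp: set_conv_nth)
    finally show ?thesis .
  qed
  show "inj_on ?F (set (k_subsets n k) \<times> {p. p permutes {0..<k}})"
  proof (intro inj_onI, clarify)
    fix K p K' p'
    assume K: "K \<in> set (k_subsets n k)" "K' \<in> set (k_subsets n k)"
      and p: "p permutes {0..<k}" "p' permutes {0..<k}"
      and eq: "restrict (\<lambda>a. K ! p a) {0..<k} = restrict (\<lambda>a. K' ! p' a) {0..<k}"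
    have "set K = set K'" using img[OF K(1) p(1)] img[OF K(2) p(2)] eq by simp
    then have "K = K'" using k_subsetsD(1)[OF K(1)] k_subsetsD(1)[OF K(2)]
      by (simp add: strict_sorted_equal)
    moreover have "p a = p' a" for a
    proof (cases "a < k")
      case True
      then have "K ! p a = K ! p' a" using fun_cong[OF eq, of a] \<open>K = K'\<close> by simp
      moreover have "p a < k" "p' a < k" using p True permutes_in_image by fastforce+
      ultimately show ?thesis using k_subsetsD(2,3)[OF K(1)] by (simp add: nth_eq_iff_index_eq)
    next
      case False
      then show ?thesis using p by (simp add: permutes_not_in)
    qed
    ultimately show "K = K' \<and> p = p'" by auto
  qed
  show "?F ` (set (k_subsets n k) \<times> {p. p permutes {0..<k}})
    = {h \<in> {0..<k} \<rightarrow>\<^sub>E {0..<n}. inj_on h {0..<k}}"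
  proof (intro equalityI subsetI)
    fix h assume "h \<in> ?F ` (set (k_subsets n k) \<times> {p. p permutes {0..<k}})"
    then obtain K p where K: "K \<in> set (k_subsets n k)" and p: "p permutes {0..<k}"
      and h: "h = ?F (K, p)" by auto
    have pk: "p a < k" if "a < k" for a using p that permutes_in_image by fastforce
    have "inj_on h {0..<k}"
    proof (rule inj_onI)
      fix a b assume "a \<in> {0..<k}" "b \<in> {0..<k}" "h a = h b"
      then have "K ! p a = K ! p b" "p a < k" "p b < k" using pk by (auto simp: h)
      then have "p a = p b" using k_subsetsD(2,3)[OF K] by (simp add: nth_eq_iff_index_eq)
      then show "a = b" using permutes_inj[OF p] by (simp add: inj_eq)
    qed
    moreover have "h \<in> {0..<k} \<rightarrow>\<^sub>E {0..<n}" using k_subsetsD(4)[OF K] pk by (auto simp: h)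
    ultimately show "h \<in> {h \<in> {0..<k} \<rightarrow>\<^sub>E {0..<n}. inj_on h {0..<k}}" by simp
  next
    fix h assume "h \<in> {h \<in> {0..<k} \<rightarrow>\<^sub>E {0..<n}. inj_on h {0..<k}}"
    then have h: "h \<in> {0..<k} \<rightarrow>\<^sub>E {0..<n}" and inj: "inj_on h {0..<k}" by auto
    define K where "K = sorted_list_of_set (h ` {0..<k})"
    have "card (h ` {0..<k}) = k" using inj by (simp add: card_image)
    then have K: "K \<in> set (k_subsets n k)" using h by (auto simp: K_def set_k_subsets)
    have setK: "set K = h ` {0..<k}" by (simp add: K_def)
    have bK: "bij_betw ((!) K) {0..<k} (h ` {0..<k})"
      using k_subsetsD(2,3)[OF K] setK by (intro bij_betw_nth) auto
    have bh: "bij_betw h {0..<k} (h ` {0..<k})" using inj by (simp add: bij_betw_def)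
    \<comment> \<open>The value at a is the position of h a in the sorted image K; outside {0..<k}
      it is the identity, as \<open>permutes\<close> requires.\<close>
    define p where "p a = (if a \<in> {0..<k} then (inv_into {0..<k} ((!) K) \<circ> h) a else a)" for a
    have "bij_betw (inv_into {0..<k} ((!) K) \<circ> h) {0..<k} {0..<k}"
      by (rule bij_betw_trans[OF bh bij_betw_inv_into[OF bK]])
    then have "bij_betw p {0..<k} {0..<k}"
      by (subst bij_betw_cong[of _ p "inv_into {0..<k} ((!) K) \<circ> h"]) (simp_all add: p_def)
    then have p: "p permutes {0..<k}" by (rule bij_imp_permutes) (simp add: p_def)
    have "h = ?F (K, p)"
    proof
      fix a show "h a = ?F (K, p) a"
      proof (cases "a < k")
        case True
        then have "h a \<in> h ` {0..<k}" by simp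
        then have "K ! inv_into {0..<k} ((!) K) (h a) = h a"
          using bij_betw_inv_into_right[OF bK] by blast
        then show ?thesis using True by (simp add: p_def)
      next
        case False
        then show ?thesis using h by (auto simp: PiE_def extensional_def)
      qed
    qed
    then show "h \<in> ?F ` (set (k_subsets n k) \<times> {p. p permutes {0..<k}})" using K p by auto
  qed
qed

section \<open>The Cauchy-Binet formula and the algebra of multiplicative compounds\<close>

lemma det_mat_expand:
  "Determinant.det (Matrix.mat k k f) =
     (\<Sum>p | p permutes {0..<k}. signof p * (\<Prod>a = 0..<k. f (a, p a)))"
proof -
  have "(\<Prod>a = 0..<k. Matrix.mat k k f $$ (a, p a)) = (\<Prod>a = 0..<k. f (a, p a))"
    if "p permutes {0..<k}" for p
    using permutes_in_image[OF that] by (intro prod.cong) auto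
  then show ?thesis by (simp add: det_def'[of _ k])
qed

text \<open>Expanding every entry of the product turns the Leibniz sum into a sum over all maps h
  from rows to inner indices. A map that is not injective repeats a row of the B-determinant and
  contributes 0. An injective one is a k-subset K with a permutation p; sorting the rows of the
  B-determinant produces the sign of p, which completes the Leibniz sum of the A-determinant. For n
  < k there are no subsets and both sides are 0.\<close>

lemma cauchy_binet:
  fixes A B :: "nat \<Rightarrow> nat \<Rightarrow> 'a::comm_ring_1"
  shows "Determinant.det (Matrix.mat k k (\<lambda>(a, b). \<Sum>l = 0..<n. A a l * B l b)) =
    (\<Sum>K\<in>set (k_subsets n k). Determinant.det (Matrix.mat k k (\<lambda>(a, b). A a (K ! b)))
       * Determinant.det (Matrix.mat k k (\<lambda>(a, b). B (K ! a) b)))"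
proof -
  let ?H = "{0..<k} \<rightarrow>\<^sub>E {0..<n}" and ?P = "{p. p permutes {0..<k}}"
  let ?D = "\<lambda>h. Determinant.det (Matrix.mat k k (\<lambda>(a, b). B (h a) b))"
  have "Determinant.det (Matrix.mat k k (\<lambda>(a, b). \<Sum>l = 0..<n. A a l * B l b))
     = (\<Sum>p\<in>?P. signof p * (\<Sum>h\<in>?H. \<Prod>a = 0..<k. A a (h a) * B (h a) (p a)))"
    by (simp add: det_mat_expand prod_sum_PiE)
  also have "\<dots> = (\<Sum>h\<in>?H. (\<Prod>a = 0..<k. A a (h a)) * ?D h)"
    unfolding det_mat_expand sum_distrib_left
    by (subst sum.swap) (simp add: prod.distrib mult_ac)
  also have "\<dots> = (\<Sum>h | h \<in> ?H \<and> inj_on h {0..<k}. (\<Prod>a = 0..<k. A a (h a)) * ?D h)"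
  proof (rule sum.mono_neutral_right)
    show "\<forall>h\<in>?H - {h \<in> ?H. inj_on h {0..<k}}. (\<Prod>a = 0..<k. A a (h a)) * ?D h = 0"
    proof
      fix h assume "h \<in> ?H - {h \<in> ?H. inj_on h {0..<k}}"
      then obtain a b where "a < k" "b < k" "a \<noteq> b" "h a = h b" by (auto simp: inj_on_def)
      then have "?D h = 0"
        by (intro det_identical_rows[of _ k a b]) (auto intro!: eq_vecI)
      then show "(\<Prod>a = 0..<k. A a (h a)) * ?D h = 0" by simp
    qed
  qed (auto intro: finite_PiE)
  also have "\<dots> = (\<Sum>(K, p)\<in>set (k_subsets n k) \<times> ?P.
      (\<Prod>a = 0..<k. A a (K ! p a)) * ?D (\<lambda>a. K ! p a))"
    by (subst sum.reindex_bij_betw[OF bij_betw_k_subsets_permutations, symmetric])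
      (auto intro!: sum.cong arg_cong2[where f = "(*)"] prod.cong
        arg_cong[where f = Determinant.det] eq_matI)
  also have "\<dots> = (\<Sum>(K, p)\<in>set (k_subsets n k) \<times> ?P.
      (signof p * (\<Prod>a = 0..<k. A a (K ! p a))) * ?D (\<lambda>a. K ! a))"
  proof (intro sum.cong refl, clarify)
    fix K p assume p: "p permutes {0..<k}"
    have "Matrix.mat k k (\<lambda>(a, b). B (K ! p a) b) = Matrix.mat k k
      (\<lambda>(i, j). Matrix.mat k k (\<lambda>(a, b). B (K ! a) b) $$ (p i, j))"
      using permutes_in_image[OF p] by (intro eq_matI) auto
    then have "?D (\<lambda>a. K ! p a) = signof p * ?D (\<lambda>a. K ! a)"
      using det_permute_rows[OF _ p, of "Matrix.mat k k (\<lambda>(a, b). B (K ! a) b)"] by simp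
    then show "(\<Prod>a = 0..<k. A a (K ! p a)) * ?D (\<lambda>a. K ! p a)
      = (signof p * (\<Prod>a = 0..<k. A a (K ! p a))) * ?D (\<lambda>a. K ! a)" by (simp add: mult_ac)
  qed
  also have "\<dots> = (\<Sum>K\<in>set (k_subsets n k).
      Determinant.det (Matrix.mat k k (\<lambda>(a, b). A a (K ! b))) * ?D (\<lambda>a. K ! a))"
    by (simp add: sum.cartesian_product[symmetric] det_mat_expand[of k "\<lambda>(a, b). A a (_ ! b)"] sum_distrib_right)
  finally show ?thesis .
qed

lemma compound_mult:
  assumes A: "A \<in> carrier_mat n m" and B: "B \<in> carrier_mat m l"
  shows "compound k (A * B) = compound k A * compound k B"
proof (rule eq_matI)
  fix i j assume "i < dim_row (compound k A * compound k B)" "j < dim_col (compound k A * compound k B)"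
  then have i: "i < n choose k" and j: "j < l choose k"
    using compound_carrier[OF A, of k] compound_carrier[OF B, of k] by auto
  let ?I = "k_subsets n k ! i" and ?J = "k_subsets l k ! j"
  note I = k_subsetsD[OF k_subsets_nth[OF i]] and J = k_subsetsD[OF k_subsets_nth[OF j]]
  have "compound k (A * B) $$ (i, j) = minor k (A * B) ?I ?J"
    using A B i j by (intro compound_index) auto
  also have "\<dots> = Determinant.det (Matrix.mat k k
      (\<lambda>(a, b). \<Sum>c = 0..<m. A $$ (?I ! a, c) * B $$ (c, ?J ! b)))"
    unfolding minor_def using A B I J
    by (intro arg_cong[where f = Determinant.det] eq_matI) (auto simp: scalar_prod_def)
  also have "\<dots> = (\<Sum>K\<in>set (k_subsets m k). minor k A ?I K * minor k B K ?J)"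
    unfolding cauchy_binet minor_def ..
  also have "\<dots> = (\<Sum>c<m choose k. minor k A ?I (k_subsets m k ! c) * minor k B (k_subsets m k ! c) ?J)"
    by (rule sum_k_subsets[symmetric])
  also have "\<dots> = (compound k A * compound k B) $$ (i, j)"
    using carrier_matD[OF A] carrier_matD[OF B] i j
    by (auto simp: scalar_prod_def compound_index[OF A] compound_index[OF B] atLeast0LessThan
        intro!: sum.cong)
  finally show "compound k (A * B) $$ (i, j) = (compound k A * compound k B) $$ (i, j)" .
qed (use compound_carrier[OF A, of k] compound_carrier[OF B, of k]
       compound_carrier[OF mult_carrier_mat[OF A B], of k] in auto)

lemma compound_transpose:
  assumes M: "M \<in> carrier_mat n m"
  shows "compound k M\<^sup>T = (compound k M)\<^sup>T"
proof (rule eq_matI)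
  fix i j assume "i < dim_row (compound k M)\<^sup>T" "j < dim_col (compound k M)\<^sup>T"
  then have i: "i < m choose k" and j: "j < n choose k" using compound_carrier[OF M, of k] by auto
  let ?I = "k_subsets m k ! i" and ?J = "k_subsets n k ! j"
  note I = k_subsetsD[OF k_subsets_nth[OF i]] and J = k_subsetsD[OF k_subsets_nth[OF j]]
  have "Matrix.mat k k (\<lambda>(a, b). M\<^sup>T $$ (?I ! a, ?J ! b))
      = (Matrix.mat k k (\<lambda>(a, b). M $$ (?J ! a, ?I ! b)))\<^sup>T"
    using I J M by (intro eq_matI) auto
  then have "minor k M\<^sup>T ?I ?J = minor k M ?J ?I"
    unfolding minor_def by (simp add: det_transpose[of _ k])
  then show "compound k M\<^sup>T $$ (i, j) = (compound k M)\<^sup>T $$ (i, j)"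
    using i j M carrier_matD[OF M]
    by (simp add: compound_index[OF M] compound_index[of "M\<^sup>T" m n])
qed (use compound_carrier[OF M, of k] compound_carrier[of "M\<^sup>T" m n k] M in auto)

text \<open>Different k-subsets have equal cardinality, so some index in I is missing from J. Its
  row in the minor is zero, and every term of the Leibniz sum contains a factor from that
  row.\<close>

lemma minor_diagonal:
  fixes d :: "nat \<Rightarrow> 'a::comm_ring_1"
  assumes I: "I \<in> set (k_subsets n k)" and J: "J \<in> set (k_subsets n k)"
  shows "minor k (Matrix.mat n n (\<lambda>(i, j). if i = j then d i else 0)) I J
    = (if I = J then \<Prod>i\<in>set I. d i else 0)"
proof -
  note I' = k_subsetsD[OF I] and J' = k_subsetsD[OF J]
  have eq: "Matrix.mat k k (\<lambda>(a, b). Matrix.mat n n (\<lambda>(i, j). if i = j then d i else 0) $$ (I ! a, J ! b))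
    = Matrix.mat k k (\<lambda>(a, b). if I ! a = J ! b then d (I ! a) else 0)"
    using I' J' by (intro eq_matI) auto
  show ?thesis
  proof (cases "I = J")
    case True
    let ?M = "Matrix.mat k k (\<lambda>(a, b). if a = b then d (I ! a) else 0)"
    have M: "Matrix.mat k k (\<lambda>(a, b). if I ! a = J ! b then d (I ! a) else 0) = ?M"
      using True I' by (intro eq_matI) (auto simp: nth_eq_iff_index_eq)
    have "Determinant.det ?M = prod_list (diag_mat ?M)"
      by (rule det_upper_triangular[of _ k]) auto
    also have "\<dots> = (\<Prod>a = 0..<k. d (I ! a))"
      by (simp add: prod_list_diag_prod)
    also have "\<dots> = (\<Prod>i\<in>set I. d i)"
      using I' by (intro prod.reindex_bij_betw bij_betw_nth) auto
    finally show ?thesis unfolding minor_def eq M using True by simp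
  next
    case False
    have "set I \<noteq> set J" using False I'(1) J'(1) strict_sorted_equal by blast
    moreover have "card (set I) = k" "card (set J) = k" using I' J' by (auto simp: distinct_card)
    ultimately have "\<not> set I \<subseteq> set J" by (metis List.finite_set card_subset_eq)
    then obtain a where a: "a < k" "I ! a \<notin> set J" using I'(3) by (metis in_set_conv_nth subsetI)
    then have "(\<Prod>x = 0..<k. if I ! x = J ! p x then d (I ! x) else 0) = 0"
      if "p permutes {0..<k}" for p
      using that J' permutes_in_image[OF that, of a]
      by (intro prod_zero) (auto intro!: bexI[of _ a])
    then show ?thesis unfolding minor_def eq det_mat_expand using False by simp
  qed
qed

lemma compound_one: "compound k (1\<^sub>m n :: 'a::comm_ring_1 Matrix.mat) = 1\<^sub>m (n choose k)"
proof (rule eq_matI)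
  fix i j assume "i < dim_row (1\<^sub>m (n choose k) :: 'a Matrix.mat)" "j < dim_col (1\<^sub>m (n choose k) :: 'a Matrix.mat)"
  then have ij: "i < n choose k" "j < n choose k" by auto
  have "(1\<^sub>m n :: 'a Matrix.mat) = Matrix.mat n n (\<lambda>(i, j). if i = j then 1 else 0)" by (simp add: one_mat_def)
  then show "compound k (1\<^sub>m n) $$ (i, j) = (1\<^sub>m (n choose k) :: 'a Matrix.mat) $$ (i, j)"
    using ij minor_diagonal[OF k_subsets_nth[OF ij(1)] k_subsets_nth[OF ij(2)], of "\<lambda>_. 1 :: 'a"]
    by (simp add: compound_index[of _ n n] nth_eq_iff_index_eq distinct_k_subsets length_k_subsets)
qed (auto simp: compound_def)

section \<open>Derivatives of compounds\<close>

text \<open>The product rule applied to the Leibniz formula. The explicit form shows linearity in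
  F', from which additivity of additive compounds is read off.\<close>

definition det_deriv :: "nat \<Rightarrow> (nat \<Rightarrow> nat \<Rightarrow> real) \<Rightarrow> (nat \<Rightarrow> nat \<Rightarrow> real) \<Rightarrow> real" where
  "det_deriv k F F' = (\<Sum>p | p permutes {0..<k}.
     signof p * (\<Sum>a = 0..<k. F' a (p a) * (\<Prod>c \<in> {0..<k} - {a}. F c (p c))))"

lemma det_has_derivative:
  assumes "\<And>a b. a < k \<Longrightarrow> b < k \<Longrightarrow> ((\<lambda>t. F t a b) has_real_derivative F' a b) (at t within S)"
  shows "((\<lambda>t. Determinant.det (Matrix.mat k k (\<lambda>(a, b). F t a b))) has_real_derivative
     det_deriv k (F t) F') (at t within S)"
proof -
  have prod: "((\<lambda>t. \<Prod>a\<in>A. F t a (p a)) has_real_derivative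
      (\<Sum>a\<in>A. F' a (p a) * (\<Prod>c\<in>A - {a}. F t c (p c)))) (at t within S)"
    if "p permutes {0..<k}" "A \<subseteq> {0..<k}" for p A
  proof -
    have "finite A" using that(2) finite_subset by blast
    then show ?thesis using that(2)
    proof (induction A)
      case (insert x A)
      have eq: "insert x A - {y} = insert x (A - {y})" if "y \<in> A" for y
        using insert.hyps that by auto
      have "((\<lambda>t. F t x (p x)) has_real_derivative F' x (p x)) (at t within S)"
        using insert.prems permutes_in_image[OF that(1), of x] by (intro assms) auto
      with insert show ?case
        by (auto intro!: derivative_eq_intros sum.cong simp: sum_distrib_left sum_distrib_right eq)
    qed auto
  qed
  show ?thesis unfolding det_mat_expand det_deriv_def prod.case
    by (intro DERIV_sum DERIV_cmult prod) auto
qed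

text \<open>Differentiation is entrywise, because matrices of all dimensions together form no single
  vector space; the carrier condition for every t keeps the dimensions constant along the
  curve.\<close>

definition mat_deriv :: "nat \<Rightarrow> nat \<Rightarrow> (real \<Rightarrow> real Matrix.mat) \<Rightarrow> real Matrix.mat \<Rightarrow> real filter \<Rightarrow> bool" where
  "mat_deriv n m X X' F \<longleftrightarrow> (\<forall>t. X t \<in> carrier_mat n m) \<and> X' \<in> carrier_mat n m \<and>
     (\<forall>i<n. \<forall>j<m. ((\<lambda>t. X t $$ (i, j)) has_real_derivative X' $$ (i, j)) F)"

text \<open>The source of the identities for additive compounds below: one curve is differentiated
  in two ways and the results are compared.\<close>

lemma mat_deriv_unique:
  assumes "mat_deriv n m X X1 (at t)" "mat_deriv n m X X2 (at t)"
  shows "X1 = X2"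
proof (rule eq_matI)
  fix i j assume "i < dim_row X2" "j < dim_col X2"
  then have "i < n" "j < m" using assms by (auto simp: mat_deriv_def)
  then have "((\<lambda>t. X t $$ (i, j)) has_real_derivative X1 $$ (i, j)) (at t)"
    "((\<lambda>t. X t $$ (i, j)) has_real_derivative X2 $$ (i, j)) (at t)"
    using assms by (auto simp: mat_deriv_def)
  then show "X1 $$ (i, j) = X2 $$ (i, j)" by (rule DERIV_unique)
qed (use assms in \<open>auto simp: mat_deriv_def\<close>)

lemma mat_deriv_mult_left:
  assumes A: "A \<in> carrier_mat n m" and X: "mat_deriv m l X X' (at t within S)"
  shows "mat_deriv n l (\<lambda>t. A * X t) (A * X') (at t within S)"
proof -
  have "X' \<in> carrier_mat m l" "\<And>t. X t \<in> carrier_mat m l"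
    and d: "\<And>i j. i < m \<Longrightarrow> j < l \<Longrightarrow> ((\<lambda>t. X t $$ (i, j)) has_real_derivative X' $$ (i, j)) (at t within S)"
    using X by (auto simp: mat_deriv_def)
  note c = carrier_matD[OF this(1)] carrier_matD[OF this(2)] this(1,2)
  have "((\<lambda>t. \<Sum>x = 0..<m. A $$ (i, x) * X t $$ (x, j)) has_real_derivative
      (\<Sum>x = 0..<m. A $$ (i, x) * X' $$ (x, j))) (at t within S)" if "i < n" "j < l" for i j
    using that by (intro DERIV_sum DERIV_cmult d) auto
  then show ?thesis using c carrier_matD[OF A] A by (auto simp: mat_deriv_def scalar_prod_def)
qed

lemma mat_deriv_transpose:
  assumes "mat_deriv n m X X' F"
  shows "mat_deriv m n (\<lambda>t. (X t)\<^sup>T) (X'\<^sup>T) F"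
proof -
  have "X' \<in> carrier_mat n m" "\<And>t. X t \<in> carrier_mat n m" using assms by (auto simp: mat_deriv_def)
  note c = carrier_matD[OF this(1)] carrier_matD[OF this(2)] this
  show ?thesis using assms c by (auto simp: mat_deriv_def)
qed

lemma mat_deriv_mult_right:
  assumes A: "A \<in> carrier_mat m l" and X: "mat_deriv n m X X' (at t within S)"
  shows "mat_deriv n l (\<lambda>t. X t * A) (X' * A) (at t within S)"
proof -
  have c: "X' \<in> carrier_mat n m" "\<And>t. X t \<in> carrier_mat n m" using X by (auto simp: mat_deriv_def)
  have "mat_deriv l n (\<lambda>t. A\<^sup>T * (X t)\<^sup>T) (A\<^sup>T * X'\<^sup>T) (at t within S)"
    using A by (intro mat_deriv_mult_left[OF _ mat_deriv_transpose[OF X]]) auto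
  from mat_deriv_transpose[OF this] show ?thesis
    using c A by (simp add: transpose_mult[of _ l m _ n])
qed

definition minor_deriv :: "nat \<Rightarrow> real Matrix.mat \<Rightarrow> real Matrix.mat \<Rightarrow> nat list \<Rightarrow> nat list \<Rightarrow> real" where
  "minor_deriv k X X' I J = det_deriv k (\<lambda>a b. X $$ (I ! a, J ! b)) (\<lambda>a b. X' $$ (I ! a, J ! b))"

text \<open>The differential of the map M -> M^(k) at X in the direction X'.\<close>

definition compound_deriv :: "nat \<Rightarrow> real Matrix.mat \<Rightarrow> real Matrix.mat \<Rightarrow> real Matrix.mat" where
  "compound_deriv k X X' = Matrix.mat (dim_row X choose k) (dim_col X choose k)
     (\<lambda>(i, j). minor_deriv k X X' (k_subsets (dim_row X) k ! i) (k_subsets (dim_col X) k ! j))"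

lemma compound_mat_deriv:
  assumes X: "mat_deriv n m X X' (at t within S)"
  shows "mat_deriv (n choose k) (m choose k) (\<lambda>t. compound k (X t)) (compound_deriv k (X t) X') (at t within S)"
proof -
  have c: "\<And>t. X t \<in> carrier_mat n m" using X by (auto simp: mat_deriv_def)
  note dim = carrier_matD[OF c]
  have "((\<lambda>t. compound k (X t) $$ (i, j)) has_real_derivative compound_deriv k (X t) X' $$ (i, j)) (at t within S)"
    if ij: "i < n choose k" "j < m choose k" for i j
  proof -
    note I = k_subsetsD[OF k_subsets_nth[OF ij(1)]] and J = k_subsetsD[OF k_subsets_nth[OF ij(2)]]
    show ?thesis
      using X ij I(4) J(4) unfolding compound_index[OF c ij] minor_def
      by (auto simp: compound_deriv_def dim minor_deriv_def mat_deriv_def intro!: det_has_derivative)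
  qed
  then show ?thesis using c by (auto simp: mat_deriv_def compound_deriv_def dim)
qed

section \<open>Laws of additive compounds\<close>

lemma mat_deriv_one_plus:
  assumes "A \<in> carrier_mat n n"
  shows "mat_deriv n n (\<lambda>\<epsilon>. 1\<^sub>m n + \<epsilon> \<cdot>\<^sub>m A) A (at 0)"
  using assms by (auto simp: mat_deriv_def intro!: derivative_eq_intros)

text \<open>The operator \<open>deriv\<close> is total, so the definition of
  \<open>add_compound\<close> becomes usable only once the derivative is known to exist; the
  differential at the identity supplies its value.\<close>

lemma add_compound_eq:
  assumes A: "A \<in> carrier_mat n n"
  shows "add_compound k A = compound_deriv k (1\<^sub>m n) A"
proof -
  have "1\<^sub>m n + 0 \<cdot>\<^sub>m A = 1\<^sub>m n" using A by (intro eq_matI) auto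
  then have "mat_deriv (n choose k) (n choose k) (\<lambda>\<epsilon>. compound k (1\<^sub>m n + \<epsilon> \<cdot>\<^sub>m A))
     (compound_deriv k (1\<^sub>m n) A) (at 0)"
    using compound_mat_deriv[OF mat_deriv_one_plus[OF A]] by simp
  then show ?thesis using A unfolding add_compound_def mat_deriv_def
    by (intro eq_matI) (auto simp: Let_def intro!: DERIV_imp_deriv)
qed

lemma add_compound_mat_deriv:
  assumes A: "A \<in> carrier_mat n n"
  shows "mat_deriv (n choose k) (n choose k) (\<lambda>\<epsilon>. compound k (1\<^sub>m n + \<epsilon> \<cdot>\<^sub>m A)) (add_compound k A) (at 0)"
proof -
  have "1\<^sub>m n + 0 \<cdot>\<^sub>m A = 1\<^sub>m n" using A by (intro eq_matI) auto
  then show ?thesis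
    using compound_mat_deriv[OF mat_deriv_one_plus[OF A]] by (simp add: add_compound_eq[OF A])
qed

lemma add_compound_carrier [simp]:
  "A \<in> carrier_mat n n \<Longrightarrow> add_compound k A \<in> carrier_mat (n choose k) (n choose k)"
  using add_compound_mat_deriv by (auto simp: mat_deriv_def)

text \<open>The differential at the identity is linear in its direction, which is visible in the
  formula \<open>det_deriv\<close>.\<close>

lemma add_compound_add:
  assumes A: "A \<in> carrier_mat n n" and B: "B \<in> carrier_mat n n"
  shows "add_compound k (A + B) = add_compound k A + add_compound k B"
proof -
  have AB: "A + B \<in> carrier_mat n n" using A B by simp
  show ?thesis
    unfolding add_compound_eq[OF A] add_compound_eq[OF B] add_compound_eq[OF AB]
  proof (rule eq_matI)
    fix i j assume "i < dim_row (compound_deriv k (1\<^sub>m n) A + compound_deriv k (1\<^sub>m n) B)"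
      "j < dim_col (compound_deriv k (1\<^sub>m n) A + compound_deriv k (1\<^sub>m n) B)"
    then have ij: "i < n choose k" "j < n choose k" by (auto simp: compound_deriv_def)
    note I = k_subsetsD[OF k_subsets_nth[OF ij(1)]] and J = k_subsetsD[OF k_subsets_nth[OF ij(2)]]
    have "p a < k" if "p permutes {0..<k}" "a < k" for p a
      using permutes_in_image[OF that(1), of a] that(2) by simp
    then show "compound_deriv k (1\<^sub>m n) (A + B) $$ (i, j)
      = (compound_deriv k (1\<^sub>m n) A + compound_deriv k (1\<^sub>m n) B) $$ (i, j)"
      using ij I(4) J(4) A B carrier_matD[OF A] carrier_matD[OF B]
      by (simp add: compound_deriv_def minor_deriv_def det_deriv_def distrib_left distrib_right
          sum.distrib)
  qed (auto simp: compound_deriv_def)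
qed

lemma add_compound_transpose:
  assumes A: "A \<in> carrier_mat n n"
  shows "add_compound k A\<^sup>T = (add_compound k A)\<^sup>T"
proof (rule mat_deriv_unique)
  have At: "A\<^sup>T \<in> carrier_mat n n" using A by simp
  show "mat_deriv (n choose k) (n choose k) (\<lambda>\<epsilon>. compound k (1\<^sub>m n + \<epsilon> \<cdot>\<^sub>m A\<^sup>T)) (add_compound k A\<^sup>T) (at 0)"
    by (rule add_compound_mat_deriv[OF At])
  have "compound k (1\<^sub>m n + \<epsilon> \<cdot>\<^sub>m A\<^sup>T) = (compound k (1\<^sub>m n + \<epsilon> \<cdot>\<^sub>m A))\<^sup>T" for \<epsilon>
  proof -
    have "1\<^sub>m n + \<epsilon> \<cdot>\<^sub>m A\<^sup>T = (1\<^sub>m n + \<epsilon> \<cdot>\<^sub>m A)\<^sup>T" using A by (intro eq_matI) auto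
    then show ?thesis using A by (simp add: compound_transpose[of _ n n])
  qed
  then show "mat_deriv (n choose k) (n choose k) (\<lambda>\<epsilon>. compound k (1\<^sub>m n + \<epsilon> \<cdot>\<^sub>m A\<^sup>T)) ((add_compound k A)\<^sup>T) (at 0)"
    using mat_deriv_transpose[OF add_compound_mat_deriv[OF A]] by simp
qed

text \<open>With P R = I the curve I + eps P A R equals P (I + eps A) R. Its compound factors by
  Cauchy-Binet, and the outer factors are constant in eps.\<close>

lemma add_compound_similar:
  assumes P: "P \<in> carrier_mat n n" and A: "A \<in> carrier_mat n n" and R: "R \<in> carrier_mat n n"
    and PR: "P * R = 1\<^sub>m n"
  shows "add_compound k (P * A * R) = compound k P * add_compound k A * compound k R"
proof (rule mat_deriv_unique)
  have PAR: "P * A * R \<in> carrier_mat n n" using P A R by simp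
  show "mat_deriv (n choose k) (n choose k) (\<lambda>\<epsilon>. compound k (1\<^sub>m n + \<epsilon> \<cdot>\<^sub>m (P * A * R))) (add_compound k (P * A * R)) (at 0)"
    by (rule add_compound_mat_deriv[OF PAR])
  have "compound k (1\<^sub>m n + \<epsilon> \<cdot>\<^sub>m (P * A * R)) = compound k P * compound k (1\<^sub>m n + \<epsilon> \<cdot>\<^sub>m A) * compound k R" for \<epsilon>
  proof -
    have "P * (1\<^sub>m n + \<epsilon> \<cdot>\<^sub>m A) * R = P * R + P * (\<epsilon> \<cdot>\<^sub>m A) * R"
      using P A R by (simp add: mult_add_distrib_mat[of _ n n _ n] add_mult_distrib_mat[of _ n n _ _ n])
    also have "\<dots> = 1\<^sub>m n + \<epsilon> \<cdot>\<^sub>m (P * A * R)"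
      using P A R PR by (simp add: mult_smult_distrib[of _ n n _ n] mult_smult_assoc_mat[of _ n n _ n])
    finally show ?thesis using P A R
      by (simp add: compound_mult[of _ n n _ n, symmetric])
  qed
  then show "mat_deriv (n choose k) (n choose k) (\<lambda>\<epsilon>. compound k (1\<^sub>m n + \<epsilon> \<cdot>\<^sub>m (P * A * R)))
     (compound k P * add_compound k A * compound k R) (at 0)"
    using mat_deriv_mult_right[OF _ mat_deriv_mult_left[OF _ add_compound_mat_deriv[OF A]]] P R by simp
qed

text \<open>The curve (I + eps A) X has velocity A X at 0, while its compound is (I + eps A)^(k)
  X^(k). Hence X' = A X implies that X^(k) solves the linear equation with matrix A^[k].\<close>

lemma compound_deriv_linear:
  assumes A: "A \<in> carrier_mat n n" and X: "X \<in> carrier_mat n m"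
  shows "compound_deriv k X (A * X) = add_compound k A * compound k X"
proof (rule mat_deriv_unique)
  have 1: "mat_deriv n m (\<lambda>\<epsilon>. (1\<^sub>m n + \<epsilon> \<cdot>\<^sub>m A) * X) (A * X) (at 0)"
    by (rule mat_deriv_mult_right[OF X mat_deriv_one_plus[OF A]])
  have "1\<^sub>m n + 0 \<cdot>\<^sub>m A = 1\<^sub>m n" using A by (intro eq_matI) auto
  then show "mat_deriv (n choose k) (m choose k) (\<lambda>\<epsilon>. compound k ((1\<^sub>m n + \<epsilon> \<cdot>\<^sub>m A) * X)) (compound_deriv k X (A * X)) (at 0)"
    using compound_mat_deriv[OF 1, of k] X by simp
  have "compound k ((1\<^sub>m n + \<epsilon> \<cdot>\<^sub>m A) * X) = compound k (1\<^sub>m n + \<epsilon> \<cdot>\<^sub>m A) * compound k X" for \<epsilon>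
    using A X by (intro compound_mult) auto
  then show "mat_deriv (n choose k) (m choose k) (\<lambda>\<epsilon>. compound k ((1\<^sub>m n + \<epsilon> \<cdot>\<^sub>m A) * X)) (add_compound k A * compound k X) (at 0)"
    using mat_deriv_mult_right[OF compound_carrier[OF X] add_compound_mat_deriv[OF A]] by simp
qed

section \<open>Diagonalization of symmetric matrices\<close>

lemma idx_bij: "bij_betw (idx :: nat \<Rightarrow> 'n::{finite,linorder}) {0..<CARD('n)} UNIV"
  unfolding idx_def by (rule bij_betw_nth) (auto simp: lessThan_atLeast0)

lemma sum_idx: "(\<Sum>i = 0..<CARD('n::{finite,linorder}). f (idx i :: 'n)) = (\<Sum>i\<in>UNIV. f i)"
  by (rule sum.reindex_bij_betw[OF idx_bij])

lemma idx_eq_iff: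
  "i < CARD('n) \<Longrightarrow> j < CARD('n) \<Longrightarrow> (idx i :: 'n::{finite,linorder}) = idx j \<longleftrightarrow> i = j"
  using idx_bij[where 'n = 'n] by (auto simp: bij_betw_def inj_on_def)

lemma symmetric_inner:
  fixes S :: "real ^ 'n ^ 'n"
  assumes "transpose S = S"
  shows "x \<bullet> (S *v y) = (S *v x) \<bullet> y"
  by (metis assms dot_lmul_matrix vector_transpose_matrix)

text \<open>The maximum of the Rayleigh quotient on the orthogonal complement of the eigenvectors found so
  far is attained at a further eigenvector.\<close>

lemma symmetric_eigenvector_orthogonal:
  fixes S :: "real ^ 'n ^ 'n"
  assumes S: "transpose S = S" and B: "finite B" "card B < CARD('n)"
    and ev: "\<And>b. b \<in> B \<Longrightarrow> \<exists>d. S *v b = d *\<^sub>R b"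
  obtains v d where "norm v = 1" "\<And>b. b \<in> B \<Longrightarrow> orthogonal b v" "S *v v = d *\<^sub>R v"
proof -
  define W where "W = {x. \<forall>b\<in>B. b \<bullet> x = 0}"
  have sub: "subspace W" by (auto simp: W_def subspace_def inner_add_right)
  have inv: "S *v x \<in> W" if "x \<in> W" for x
  proof -
    have "b \<bullet> (S *v x) = 0" if b: "b \<in> B" for b
    proof -
      obtain d where "S *v b = d *\<^sub>R b" using ev b by blast
      then show ?thesis using symmetric_inner[OF S, of b x] \<open>x \<in> W\<close> b by (simp add: W_def)
    qed
    then show ?thesis by (simp add: W_def)
  qed
  have "dim B < DIM(real ^ 'n)" using dim_le_card'[OF B(1)] B(2) by simp
  then obtain x where x: "x \<noteq> 0" "\<And>y. y \<in> span B \<Longrightarrow> orthogonal x y"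
    using orthogonal_to_subspace_exists by blast
  then have "x \<in> W" by (auto simp: W_def real_inner_class.orthogonal_def inner_commute span_base)
  then have "(1 / norm x) *\<^sub>R x \<in> W \<inter> sphere 0 1" using x(1) sub by (simp add: subspace_scale)
  moreover have "compact (W \<inter> sphere 0 1)" using closed_subspace[OF sub] by (rule closed_Int_compact) simp
  moreover have "continuous_on (W \<inter> sphere 0 1) (\<lambda>x. x \<bullet> (S *v x))"
    by (intro continuous_intros linear_continuous_on matrix_vector_mul_bounded_linear)
  ultimately obtain v where v: "v \<in> W" "norm v = 1"
    and max: "\<And>x. x \<in> W \<Longrightarrow> norm x = 1 \<Longrightarrow> x \<bullet> (S *v x) \<le> v \<bullet> (S *v v)"
    using continuous_attains_sup[of "W \<inter> sphere 0 1" "\<lambda>x. x \<bullet> (S *v x)"]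
    by (metis IntE IntI dist_0_norm empty_iff mem_sphere)
  define c where "c = v \<bullet> (S *v v)"
  \<comment> \<open>The form and the squared norm are both homogeneous of degree two, so the maximum
    on the unit sphere bounds the form on all of W.\<close>
  have le: "x \<bullet> (S *v x) \<le> c * (x \<bullet> x)" if "x \<in> W" for x
  proof (cases "x = 0")
    case False
    let ?y = "(1 / norm x) *\<^sub>R x"
    have "?y \<bullet> (S *v ?y) \<le> c" unfolding c_def using False that sub by (intro max) (auto simp: subspace_scale)
    then show ?thesis using False
      by (simp add: matrix_vector_mult_scaleR divide_simps dot_square_norm power2_eq_square mult_ac)
  qed simp
  define u where "u = S *v v - c *\<^sub>R v"
  have uW: "u \<in> W" unfolding u_def using v inv sub by (simp add: subspace_diff subspace_scale)
  define M where "M = c * (u \<bullet> u) - u \<bullet> (S *v u)"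
  have M: "M \<ge> 0" using le[OF uW] by (simp add: M_def)
  \<comment> \<open>The residual u = S v - c v lies in W, so v may be perturbed along it. In the
    maximality inequality for v + t u the constant terms and the terms with u . v cancel, leaving a
    first-order gain against a second-order loss.\<close>
  have quad: "2 * t * (u \<bullet> u) \<le> t\<^sup>2 * M" for t
  proof -
    have "v + t *\<^sub>R u \<in> W" using v uW sub by (simp add: subspace_add subspace_scale)
    from le[OF this] have q: "(v + t *\<^sub>R u) \<bullet> (S *v (v + t *\<^sub>R u)) \<le> c * ((v + t *\<^sub>R u) \<bullet> (v + t *\<^sub>R u))" .
    have q1: "(v + t *\<^sub>R u) \<bullet> (S *v (v + t *\<^sub>R u)) = c + 2 * t * (u \<bullet> (S *v v)) + t\<^sup>2 * (u \<bullet> (S *v u))"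
    proof -
      have "v \<bullet> (S *v u) = u \<bullet> (S *v v)" using symmetric_inner[OF S, of v u] by (metis inner_commute)
      then show ?thesis
        by (simp add: c_def matrix_vector_right_distrib matrix_vector_mult_scaleR inner_add_left
            inner_add_right power2_eq_square distrib_left)
    qed
    have q2: "(v + t *\<^sub>R u) \<bullet> (v + t *\<^sub>R u) = 1 + 2 * t * (u \<bullet> v) + t\<^sup>2 * (u \<bullet> u)"
    proof -
      have "v \<bullet> v = 1" using v by (simp add: dot_square_norm)
      then show ?thesis
        by (simp add: inner_add_left inner_add_right inner_commute[of v u] power2_eq_square distrib_left)
    qed
    have q3: "u \<bullet> (S *v v) = u \<bullet> u + c * (u \<bullet> v)"
    proof -
      have "S *v v = u + c *\<^sub>R v" by (simp add: u_def)
      then show ?thesis by (simp add: inner_add_right)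
    qed
    show ?thesis using q unfolding q1 q2 q3 M_def by (simp add: algebra_simps)
  qed
  \<comment> \<open>A step size at which the gain exceeds the loss unless u = 0: it gives 2 |u|^2 <=
    s M <= |u|^2. The summand 1 keeps the denominator positive when M = 0.\<close>
  define s where "s = (u \<bullet> u) / (M + 1)"
  have "u \<bullet> u \<le> 0"
  proof (rule ccontr)
    assume "\<not> u \<bullet> u \<le> 0"
    then have pos: "u \<bullet> u > 0" by linarith
    then have "s > 0" using M by (simp add: s_def)
    have "s * (2 * (u \<bullet> u)) \<le> s * (s * M)" using quad[of s] by (simp add: power2_eq_square mult_ac)
    then have "2 * (u \<bullet> u) \<le> s * M" using \<open>s > 0\<close> by simp
    also have "\<dots> \<le> s * (M + 1)" using \<open>s > 0\<close> by simp
    also have "\<dots> = u \<bullet> u" using M by (simp add: s_def)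
    finally show False using pos by simp
  qed
  then have "u = 0" by (metis inner_gt_zero_iff not_less)
  then have "S *v v = c *\<^sub>R v" by (simp add: u_def)
  then show thesis using that v by (auto simp: W_def real_inner_class.orthogonal_def)
qed

lemma symmetric_eigenbasis:
  fixes S :: "real ^ 'n ^ 'n"
  assumes S: "transpose S = S"
  obtains B where "finite B" "card B = CARD('n)" "pairwise orthogonal B"
    "\<And>b. b \<in> B \<Longrightarrow> norm b = 1" "\<And>b. b \<in> B \<Longrightarrow> \<exists>d. S *v b = d *\<^sub>R b"
proof -
  have "\<exists>B. finite B \<and> card B = m \<and> pairwise orthogonal B \<and>
    (\<forall>b\<in>B. norm b = 1 \<and> (\<exists>d. S *v b = d *\<^sub>R b))" if "m \<le> CARD('n)" for m
    using that
  proof (induction m)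
    case 0
    show ?case by (intro exI[of _ "{}"]) auto
  next
    case (Suc m)
    then obtain B where B: "finite B" "card B = m" "pairwise orthogonal B"
      "\<And>b. b \<in> B \<Longrightarrow> norm b = 1" "\<And>b. b \<in> B \<Longrightarrow> \<exists>d. S *v b = d *\<^sub>R b" by auto
    have "card B < CARD('n)" using B(2) Suc.prems by simp
    then obtain v d where v: "norm v = 1" "\<And>b. b \<in> B \<Longrightarrow> orthogonal b v" "S *v v = d *\<^sub>R v"
      using symmetric_eigenvector_orthogonal[OF S B(1) _ B(5)] by blast
    have "v \<notin> B" using v by (metis orthogonal_self norm_zero zero_neq_one)
    then show ?case using B v
      by (intro exI[of _ "insert v B"])
        (auto simp: pairwise_insert orthogonal_commute[of v])
  qed
  from this[OF order.refl] show thesis using that by blast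
qed

lemma to_mat_carrier [simp]:
  "to_mat (M :: 'a ^ 'm::{finite,linorder} ^ 'n::{finite,linorder}) \<in> carrier_mat CARD('n) CARD('m)"
  by (simp add: to_mat_def)

definition diagonal_of :: "real list \<Rightarrow> real Matrix.mat" where
  "diagonal_of ds = Matrix.mat (length ds) (length ds) (\<lambda>(i, j). if i = j then ds ! i else 0)"

lemma proots_prod_linear_factors: "proots (\<Prod>a\<leftarrow>ds. [:- a, 1:]) = mset (ds :: real list)"
proof (induction ds)
  case (Cons a ds)
  have "(\<Prod>a\<leftarrow>ds. [:- a, 1:]) \<noteq> 0" by auto
  then have "proots (\<Prod>a\<leftarrow>a # ds. [:- a, 1:]) = proots [:- a, 1:] + proots (\<Prod>a\<leftarrow>ds. [:- a, 1:])"
    unfolding list.map prod_list.Cons by (intro proots_mult) auto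
  then show ?case using Cons by simp
qed simp

text \<open>The orthonormal eigenbasis becomes the columns of U. Similarity makes \<open>ds\<close>
  the multiset of roots of the characteristic polynomial, and since \<open>ds\<close> is descending
  it is the very list that \<open>ord_eigenvalue\<close> reads. The eigenvectors in the last
  conclusion serve to test the sign of a form.\<close>

lemma symmetric_diagonalization:
  fixes S :: "real ^ 'n::{finite,linorder} ^ 'n::{finite,linorder}"
  assumes S: "transpose S = S"
  obtains U ds where "U \<in> carrier_mat CARD('n) CARD('n)" "length ds = CARD('n)"
    "sorted_wrt (\<ge>) ds" "U * U\<^sup>T = 1\<^sub>m CARD('n)" "to_mat S = U * diagonal_of ds * U\<^sup>T"
    "\<And>i. 1 \<le> i \<Longrightarrow> i \<le> CARD('n) \<Longrightarrow> ord_eigenvalue (to_mat S) i = ds ! (i - 1)"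
    "\<And>i. i < CARD('n) \<Longrightarrow> \<exists>b. norm b = 1 \<and> S *v b = (ds ! i) *\<^sub>R b"
proof -
  let ?n = "CARD('n)"
  obtain B where B: "finite B" "card B = CARD('n)" "pairwise orthogonal B"
    "\<And>b. b \<in> B \<Longrightarrow> norm b = 1" "\<And>b. b \<in> B \<Longrightarrow> \<exists>d. S *v b = d *\<^sub>R b"
    using symmetric_eigenbasis[OF S] by metis
  then obtain d where d: "\<And>b. b \<in> B \<Longrightarrow> S *v b = d b *\<^sub>R b" by metis
  obtain bs0 where bs0: "set bs0 = B" "distinct bs0" using finite_distinct_list[OF B(1)] by auto
  \<comment> \<open>Sorting by the negated eigenvalue lists the eigenvalues in descending
    order.\<close>
  define bs where "bs = sort_key (\<lambda>b. - d b) bs0"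
  have bs: "set bs = B" "distinct bs" "length bs = ?n"
    using bs0 B(2) distinct_card[OF bs0(2)] by (auto simp: bs_def)
  define ds where "ds = map d bs"
  have len: "length ds = ?n" by (simp add: ds_def bs)
  have "sorted (map (\<lambda>b. - d b) bs)" by (simp add: bs_def)
  then have sorted: "sorted_wrt (\<ge>) ds" by (simp add: ds_def sorted_wrt_map)
  define U where "U = Matrix.mat ?n ?n (\<lambda>(i, j). (bs ! j) $ idx i)"
  have U: "U \<in> carrier_mat ?n ?n" by (simp add: U_def)
  have D: "diagonal_of ds \<in> carrier_mat ?n ?n" by (simp add: diagonal_of_def len)
  have nth: "bs ! i \<in> B" if "i < ?n" for i using that bs by auto
  have "U\<^sup>T * U = 1\<^sub>m ?n"
  proof (rule eq_matI)
    fix i j assume "i < dim_row (1\<^sub>m ?n :: real Matrix.mat)" "j < dim_col (1\<^sub>m ?n :: real Matrix.mat)"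
    then have ij: "i < ?n" "j < ?n" by auto
    then have "(U\<^sup>T * U) $$ (i, j) = (bs ! i) \<bullet> (bs ! j)"
      using sum_idx[of "\<lambda>x. bs ! i $ x * bs ! j $ x"]
      by (simp add: U_def scalar_prod_def inner_vec_def)
    also have "\<dots> = (if i = j then 1 else 0)"
    proof (cases "i = j")
      case True
      then show ?thesis using B(4)[OF nth[OF ij(1)]] by (simp add: dot_square_norm)
    next
      case False
      then have "bs ! i \<noteq> bs ! j" using ij bs by (simp add: nth_eq_iff_index_eq)
      then show ?thesis using False B(3) nth ij by (auto simp: pairwise_def real_inner_class.orthogonal_def)
    qed
    finally show "(U\<^sup>T * U) $$ (i, j) = (1\<^sub>m ?n :: real Matrix.mat) $$ (i, j)" using ij by simp
  qed (simp_all add: U_def)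
  then have UU: "U * U\<^sup>T = 1\<^sub>m ?n" using U mat_mult_left_right_inverse[of "U\<^sup>T" ?n U] by simp
  have "to_mat S * U = U * diagonal_of ds"
  proof (rule eq_matI)
    fix i j assume "i < dim_row (U * diagonal_of ds)" "j < dim_col (U * diagonal_of ds)"
    then have ij: "i < ?n" "j < ?n" by (auto simp: U_def diagonal_of_def len)
    have "(to_mat S * U) $$ (i, j) = (S *v (bs ! j)) $ idx i"
      using ij sum_idx[of "\<lambda>x. S $ idx i $ x * bs ! j $ x"]
      by (simp add: to_mat_def U_def scalar_prod_def matrix_vector_mult_def)
    also have "\<dots> = ds ! j * (bs ! j) $ idx i" using d nth ij bs by (simp add: ds_def)
    also have "\<dots> = (U * diagonal_of ds) $$ (i, j)"
      using ij len by (simp add: U_def diagonal_of_def scalar_prod_def if_distrib sum.delta cong: if_cong)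
    finally show "(to_mat S * U) $$ (i, j) = (U * diagonal_of ds) $$ (i, j)" .
  qed (auto simp: U_def diagonal_of_def len to_mat_def)
  then have "to_mat S * U * U\<^sup>T = U * diagonal_of ds * U\<^sup>T" by simp
  moreover have "to_mat S * U * U\<^sup>T = to_mat S"
    using assoc_mult_mat[OF to_mat_carrier[of S] U, of "U\<^sup>T"] U UU
      right_mult_one_mat[OF to_mat_carrier[of S]] by simp
  ultimately have SU: "to_mat S = U * diagonal_of ds * U\<^sup>T" by simp
  then have "similar_mat (to_mat S) (diagonal_of ds)"
    unfolding similar_mat_def similar_mat_wit_def Let_def
    using U D UU \<open>U\<^sup>T * U = 1\<^sub>m ?n\<close> by (intro exI[of _ U] exI[of _ "U\<^sup>T"]) (auto simp: to_mat_def)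
  then have "char_poly (to_mat S) = char_poly (diagonal_of ds)" by (rule char_poly_similar)
  also have "\<dots> = (\<Prod>a\<leftarrow>diag_mat (diagonal_of ds). [:- a, 1:])"
    by (rule char_poly_upper_triangular[OF D]) (auto simp: diagonal_of_def)
  also have "diag_mat (diagonal_of ds) = ds"
    by (auto simp: diag_mat_def diagonal_of_def intro!: nth_equalityI)
  finally have "proots (char_poly (to_mat S)) = mset ds" by (simp add: proots_prod_linear_factors)
  moreover have "sorted (rev ds)" using sorted by (simp add: sorted_wrt_rev)
  ultimately have "rev (sorted_list_of_multiset (proots (char_poly (to_mat S)))) = ds"
    by (metis mset_rev rev_rev_ident sorted_list_of_multiset_mset sorted_sort_id)
  then have "ord_eigenvalue (to_mat S) i = ds ! (i - 1)" for i by (simp add: ord_eigenvalue_def)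
  moreover have "\<exists>b. norm b = 1 \<and> S *v b = (ds ! i) *\<^sub>R b" if "i < ?n" for i
    using d[OF nth[OF that]] B(4)[OF nth[OF that]] that bs by (auto simp: ds_def)
  ultimately show thesis using that U len sorted UU SU by blast
qed

section \<open>Quadratic forms of additive compounds\<close>

lemma diagonal_of_carrier [simp]: "diagonal_of ds \<in> carrier_mat (length ds) (length ds)"
  by (simp add: diagonal_of_def)

text \<open>By \<open>minor_diagonal\<close> the compound of I + eps D is diagonal, with entries the
  products of 1 + eps d_x over x in K. Their derivatives at 0 are the sums of d_x over K.\<close>

lemma add_compound_diagonal:
  assumes n: "length ds = n" and ij: "i < n choose k" "j < n choose k"
  shows "add_compound k (diagonal_of ds) $$ (i, j)
    = (if i = j then \<Sum>x\<in>set (k_subsets n k ! i). ds ! x else 0)"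
proof (rule DERIV_unique)
  have D: "diagonal_of ds \<in> carrier_mat n n" using n by auto
  show "((\<lambda>\<epsilon>. compound k (1\<^sub>m n + \<epsilon> \<cdot>\<^sub>m diagonal_of ds) $$ (i, j)) has_real_derivative
      add_compound k (diagonal_of ds) $$ (i, j)) (at 0)"
    using add_compound_mat_deriv[OF D, of k] ij by (simp add: mat_deriv_def)
  have one_plus: "1\<^sub>m n + \<epsilon> \<cdot>\<^sub>m diagonal_of ds
      = Matrix.mat n n (\<lambda>(i, j). if i = j then 1 + \<epsilon> * ds ! i else 0)" for \<epsilon>
    using n by (intro eq_matI) (auto simp: diagonal_of_def)
  have "k_subsets n k ! i = k_subsets n k ! j \<longleftrightarrow> i = j"
    using ij by (simp add: nth_eq_iff_index_eq distinct_k_subsets length_k_subsets)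
  then have entry: "compound k (1\<^sub>m n + \<epsilon> \<cdot>\<^sub>m diagonal_of ds) $$ (i, j)
      = (if i = j then \<Prod>x\<in>set (k_subsets n k ! i). 1 + \<epsilon> * ds ! x else 0)" for \<epsilon>
    unfolding one_plus using ij
    by (simp add: compound_index[of _ n n] minor_diagonal[OF k_subsets_nth k_subsets_nth])
  have "((\<lambda>\<epsilon>. \<Prod>x\<in>A. 1 + \<epsilon> * ds ! x) has_real_derivative (\<Sum>x\<in>A. ds ! x)) (at 0)" for A
  proof -
    have "((\<lambda>\<epsilon>. 1 + \<epsilon> * ds ! x) has_real_derivative ds ! x) (at 0)" for x
      by (auto intro!: derivative_eq_intros)
    from has_field_derivative_prod[of A "\<lambda>x \<epsilon>. 1 + \<epsilon> * ds ! x", OF this] show ?thesis by simp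
  qed
  then show "((\<lambda>\<epsilon>. compound k (1\<^sub>m n + \<epsilon> \<cdot>\<^sub>m diagonal_of ds) $$ (i, j)) has_real_derivative
      (if i = j then \<Sum>x\<in>set (k_subsets n k ! i). ds ! x else 0)) (at 0)"
    unfolding entry by simp
qed

lemma strict_sorted_nth_ge:
  fixes I :: "nat list"
  assumes "sorted_wrt (<) I" "a < length I"
  shows "a \<le> I ! a"
  using assms(2)
proof (induction a)
  case (Suc a)
  then have "I ! a < I ! Suc a" using assms(1) by (simp add: sorted_wrt_nth_less)
  then show ?case using Suc by simp
qed simp

text \<open>In an increasing list of naturals the entry at position a is at least a, so the two sums
  compare term by term for a descending \<open>ds\<close>.\<close>

lemma sum_k_subset_le:
  fixes ds :: "real list"
  assumes ds: "sorted_wrt (\<ge>) ds" and I: "I \<in> set (k_subsets (length ds) k)"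
  shows "(\<Sum>x\<in>set I. ds ! x) \<le> (\<Sum>a = 0..<k. ds ! a)"
proof -
  note I' = k_subsetsD[OF I]
  have "(\<Sum>x\<in>set I. ds ! x) = (\<Sum>a = 0..<k. ds ! (I ! a))"
    using I' by (intro sum.reindex_bij_betw[symmetric] bij_betw_nth) auto
  also have "\<dots> \<le> (\<Sum>a = 0..<k. ds ! a)"
  proof (rule sum_mono)
    fix a assume "a \<in> {0..<k}"
    then have "a \<le> I ! a" "I ! a < length ds" using strict_sorted_nth_ge[OF I'(1)] I' by auto
    then show "ds ! (I ! a) \<le> ds ! a"
      using ds by (cases "a = I ! a") (auto simp: sorted_wrt_iff_nth_less)
  qed
  finally show ?thesis .
qed

lemma scalar_prod_congruence:
  fixes w :: "real Matrix.vec"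
  assumes U: "U \<in> carrier_mat n m" and D: "D \<in> carrier_mat m m" and w: "w \<in> carrier_vec n"
  shows "scalar_prod w ((U * D * U\<^sup>T) *\<^sub>v w) = scalar_prod (U\<^sup>T *\<^sub>v w) (D *\<^sub>v (U\<^sup>T *\<^sub>v w))"
proof -
  have z: "U\<^sup>T *\<^sub>v w \<in> carrier_vec m" using U w by auto
  have "(U * D * U\<^sup>T) *\<^sub>v w = U *\<^sub>v (D *\<^sub>v (U\<^sup>T *\<^sub>v w))"
    using U D w z by (simp add: assoc_mult_mat_vec[of _ n m _ n] assoc_mult_mat_vec[of _ n m _ m])
  then show ?thesis using transpose_vec_mult_scalar[OF U _ w] z D by simp
qed

text \<open>Compounds respect products and transposes, so U^(k) is again orthogonal. It brings S^[k]
  to diagonal form in coordinates z of the same length as w, where each diagonal entry is a sum of k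
  eigenvalues with distinct positions in \<open>ds\<close>.\<close>

lemma add_compound_quadratic_le:
  fixes S :: "real ^ 'n::{finite,linorder} ^ 'n::{finite,linorder}"
  assumes S: "transpose S = S" and k: "k \<le> CARD('n)" and w: "w \<in> carrier_vec (CARD('n) choose k)"
  shows "scalar_prod w (add_compound k (to_mat S) *\<^sub>v w)
    \<le> (\<Sum>i=1..k. ord_eigenvalue (to_mat S) i) * scalar_prod w w"
proof -
  let ?n = "CARD('n)"
  obtain U ds where U: "U \<in> carrier_mat ?n ?n" and len: "length ds = ?n"
    and sorted: "sorted_wrt (\<ge>) ds" and UU: "U * U\<^sup>T = 1\<^sub>m ?n"
    and SU: "to_mat S = U * diagonal_of ds * U\<^sup>T"
    and ev: "\<And>i. 1 \<le> i \<Longrightarrow> i \<le> ?n \<Longrightarrow> ord_eigenvalue (to_mat S) i = ds ! (i - 1)"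
    using symmetric_diagonalization[OF S] by metis
  define N where "N = ?n choose k"
  define Uk where "Uk = compound k U"
  define Dk where "Dk = add_compound k (diagonal_of ds)"
  define z where "z = Uk\<^sup>T *\<^sub>v w"
  define c where "c = (\<Sum>a = 0..<k. ds ! a)"
  have D: "diagonal_of ds \<in> carrier_mat ?n ?n" using diagonal_of_carrier[of ds] len by simp
  have Uk: "Uk \<in> carrier_mat N N" and Dk: "Dk \<in> carrier_mat N N" and w: "w \<in> carrier_vec N"
    using U D w by (auto simp: Uk_def Dk_def N_def)
  then have z: "z \<in> carrier_vec N" by (auto simp: z_def)
  have "add_compound k (to_mat S) = Uk * Dk * Uk\<^sup>T"
    unfolding SU Uk_def Dk_def using add_compound_similar[OF U D _ UU] U
    by (simp add: compound_transpose)
  then have "scalar_prod w (add_compound k (to_mat S) *\<^sub>v w) = scalar_prod z (Dk *\<^sub>v z)"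
    using scalar_prod_congruence[OF Uk Dk w] by (simp add: z_def)
  also have "\<dots> = (\<Sum>i = 0..<N. vec_index z i * (\<Sum>j = 0..<N. Dk $$ (i, j) * vec_index z j))"
    using z Dk by (auto simp: scalar_prod_def mult_mat_vec_def intro!: sum.cong)
  also have "\<dots> = (\<Sum>i = 0..<N. (\<Sum>x\<in>set (k_subsets ?n k ! i). ds ! x) * (vec_index z i)\<^sup>2)"
    by (intro sum.cong)
      (auto simp: Dk_def N_def add_compound_diagonal[OF len] if_distrib[of "\<lambda>x. x * _"] power2_eq_square
        cong: if_cong)
  also have "\<dots> \<le> (\<Sum>i = 0..<N. c * (vec_index z i)\<^sup>2)"
    unfolding c_def using len
    by (intro sum_mono mult_right_mono sum_k_subset_le[OF sorted]) (auto simp: N_def k_subsets_nth)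
  also have "\<dots> = c * scalar_prod z z"
    using z by (auto simp: scalar_prod_def sum_distrib_left power2_eq_square)
  also have "scalar_prod z z = scalar_prod w w"
  proof -
    have "Uk * Uk\<^sup>T = compound k (U * U\<^sup>T)"
      unfolding Uk_def using U by (simp add: compound_mult[of _ ?n ?n] compound_transpose)
    then have "Uk * Uk\<^sup>T = 1\<^sub>m N" by (simp add: UU compound_one N_def)
    then have "Uk *\<^sub>v z = w" using Uk w by (simp add: z_def assoc_mult_mat_vec[of _ N N _ N, symmetric])
    then show ?thesis using transpose_vec_mult_scalar[OF Uk z w] by (simp add: z_def)
  qed
  \<comment> \<open>Index shift: \<open>ord_eigenvalue\<close> counts from 1, the list
    \<open>ds\<close> from 0.\<close>
  also have "c = (\<Sum>i=1..k. ord_eigenvalue (to_mat S) i)"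
    unfolding c_def using k ev by (intro sum.reindex_bij_witness[of _ "\<lambda>i. i - 1" Suc]) auto
  finally show ?thesis .
qed

text \<open>At a unit eigenvector the form takes the eigenvalue as its value, so each summand is
  nonpositive.\<close>

lemma sum_ord_eigenvalue_nonpos:
  fixes S :: "real ^ 'n::{finite,linorder} ^ 'n::{finite,linorder}"
  assumes S: "transpose S = S" and k: "k \<le> CARD('n)" and neg: "\<And>v. v \<bullet> (S *v v) \<le> 0"
  shows "(\<Sum>i=1..k. ord_eigenvalue (to_mat S) i) \<le> 0"
proof (rule sum_nonpos)
  fix i assume i: "i \<in> {1..k}"
  obtain ds where ev: "\<And>i. 1 \<le> i \<Longrightarrow> i \<le> CARD('n) \<Longrightarrow> ord_eigenvalue (to_mat S) i = ds ! (i - 1)"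
    and vec: "\<And>i. i < CARD('n) \<Longrightarrow> \<exists>b. norm b = 1 \<and> S *v b = (ds ! i) *\<^sub>R b"
    using symmetric_diagonalization[OF S] by metis
  obtain b where b: "norm b = 1" "S *v b = (ds ! (i - 1)) *\<^sub>R b" using vec[of "i - 1"] i k
    by (metis One_nat_def Suc_le_eq Suc_pred atLeastAtMost_iff le_trans)
  then have "b \<bullet> (S *v b) = ds ! (i - 1)" by (simp add: dot_square_norm)
  then show "ord_eigenvalue (to_mat S) i \<le> 0" using neg[of b] ev[of i] i k by simp
qed

section \<open>The largest eigenvalue of a symmetric matrix of arbitrary size\<close>

lemma scalar_prod_self_pos:
  fixes v :: "real Matrix.vec"
  assumes "v \<in> carrier_vec n" "v \<noteq> 0\<^sub>v n"
  shows "scalar_prod v v > 0"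
proof -
  obtain i where "i < n" "vec_index v i \<noteq> 0" using assms by (metis carrier_vecD eq_vecI index_zero_vec)
  then have "(\<Sum>i = 0..<n. (vec_index v i)\<^sup>2) > 0" by (intro sum_pos2[of _ i]) auto
  then show ?thesis using assms by (simp add: scalar_prod_def power2_eq_square)
qed

lemma symmetric_scalar_prod:
  fixes N :: "real Matrix.mat"
  assumes "N \<in> carrier_mat n n" "N\<^sup>T = N" "v \<in> carrier_vec n" "w \<in> carrier_vec n"
  shows "scalar_prod v (N *\<^sub>v w) = scalar_prod w (N *\<^sub>v v)"
  using transpose_vec_mult_scalar[OF assms(1) assms(4,3)] assms
  by (simp add: comm_scalar_prod[of "N *\<^sub>v v" n])

text \<open>A complex eigenvector splits into its real and imaginary part, and symmetry forces the
  eigenvalue to be real.\<close>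

lemma symmetric_has_real_eigenvalue:
  fixes N :: "real Matrix.mat"
  assumes N: "N \<in> carrier_mat n n" and sym: "N\<^sup>T = N" and n: "n > 0"
  obtains r where "eigenvalue N r"
proof -
  define M where "M = map_mat complex_of_real N"
  have M: "M \<in> carrier_mat n n" using N by (simp add: M_def)
  obtain as where as: "char_poly M = (\<Prod>a\<leftarrow>as. [:- a, 1:])" "length as = n"
    using char_poly_factorized[OF M] by auto
  then obtain l as' where "as = l # as'" using n by (cases as) auto
  then have "eigenvalue M l" using as eigenvalue_root_char_poly[OF M] by simp
  then obtain v where v: "v \<in> carrier_vec n" "v \<noteq> 0\<^sub>v n" "M *\<^sub>v v = l \<cdot>\<^sub>v v"
    using M by (auto simp: eigenvalue_def eigenvector_def)
  define a where "a = map_vec Re v"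
  define b where "b = map_vec Im v"
  have ab: "a \<in> carrier_vec n" "b \<in> carrier_vec n" using v by (auto simp: a_def b_def)
  have Mv: "(\<Sum>j = 0..<n. complex_of_real (N $$ (i, j)) * vec_index v j) = l * vec_index v i" if "i < n" for i
    using arg_cong[OF v(3), of "\<lambda>x. vec_index x i"] that v M N
    by (simp add: M_def scalar_prod_def)
  have Na: "N *\<^sub>v a = Re l \<cdot>\<^sub>v a - Im l \<cdot>\<^sub>v b"
    using N v arg_cong[OF Mv, of _ Re] by (intro eq_vecI) (auto simp: a_def b_def scalar_prod_def)
  have Nb: "N *\<^sub>v b = Re l \<cdot>\<^sub>v b + Im l \<cdot>\<^sub>v a"
    using N v arg_cong[OF Mv, of _ Im] by (intro eq_vecI) (auto simp: a_def b_def scalar_prod_def)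
  have "scalar_prod b (N *\<^sub>v a) = scalar_prod a (N *\<^sub>v b)"
    by (rule symmetric_scalar_prod[OF N sym ab(2,1)])
  \<comment> \<open>By symmetry b . N a = a . N b; inserting \<open>Na\<close> and \<open>Nb\<close>
    cancels the terms with Re l and leaves Im l times |a|^2 + |b|^2.\<close>
  then have im: "Im l * (scalar_prod a a + scalar_prod b b) = 0"
    using ab unfolding Na Nb
    by (simp add: scalar_prod_minus_distrib[of _ n] scalar_prod_add_distrib[of _ n]
        comm_scalar_prod[of b n a] algebra_simps)
  have nz: "a \<noteq> 0\<^sub>v n \<or> b \<noteq> 0\<^sub>v n"
  proof (rule ccontr)
    assume "\<not> (a \<noteq> 0\<^sub>v n \<or> b \<noteq> 0\<^sub>v n)"
    then have "vec_index a i = 0" "vec_index b i = 0" if "i < n" for i using that by auto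
    then have "v = 0\<^sub>v n" using v(1) by (intro eq_vecI) (auto simp: a_def b_def complex_eq_iff)
    then show False using v(2) by simp
  qed
  have "scalar_prod a a \<ge> 0" "scalar_prod b b \<ge> 0"
    by (auto simp: scalar_prod_def intro: sum_nonneg)
  then have "scalar_prod a a + scalar_prod b b > 0"
    using nz scalar_prod_self_pos[OF ab(1)] scalar_prod_self_pos[OF ab(2)]
    by (metis add_nonneg_pos add_pos_nonneg)
  with im have "Im l = 0" by simp
  then have "N *\<^sub>v a = Re l \<cdot>\<^sub>v a" "N *\<^sub>v b = Re l \<cdot>\<^sub>v b" using Na Nb ab by auto
  then have "eigenvalue N (Re l)" using nz ab N unfolding eigenvalue_def eigenvector_def by auto
  then show thesis by (rule that)
qed

text \<open>\<open>ord_eigenvalue N 1\<close> is the head of a reversed list of roots, so it is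
  meaningful only if that list is nonempty. This is where n > 0 and the existence of a real
  eigenvalue enter. It is then an eigenvalue itself, and the bound is evaluated at its
  eigenvector.\<close>

lemma ord_eigenvalue_first_le:
  assumes N: "N \<in> carrier_mat n n" and sym: "N\<^sup>T = N" and n: "n > 0"
    and le: "\<And>w. w \<in> carrier_vec n \<Longrightarrow> scalar_prod w (N *\<^sub>v w) \<le> c * scalar_prod w w"
  shows "ord_eigenvalue N 1 \<le> c"
proof -
  have nz: "char_poly N \<noteq> 0" using degree_monic_char_poly[OF N] by auto
  obtain r where "eigenvalue N r" using symmetric_has_real_eigenvalue[OF N sym n] .
  then have "r \<in># proots (char_poly N)" using nz eigenvalue_root_char_poly[OF N] by simp
  then have "sorted_list_of_multiset (proots (char_poly N)) \<noteq> []"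
    by (metis empty_iff mset.simps(1) mset_sorted_list_of_multiset set_mset_empty)
  note last = last_in_set[OF this] and ne = this
  have "ord_eigenvalue N 1 = last (sorted_list_of_multiset (proots (char_poly N)))"
    using ne by (simp add: ord_eigenvalue_def hd_conv_nth[symmetric] hd_rev)
  with last have "ord_eigenvalue N 1 \<in># proots (char_poly N)"
    by (metis mset_sorted_list_of_multiset set_mset_mset)
  then have "eigenvalue N (ord_eigenvalue N 1)" using nz eigenvalue_root_char_poly[OF N] by simp
  then obtain v where v: "v \<in> carrier_vec n" "v \<noteq> 0\<^sub>v n" "N *\<^sub>v v = ord_eigenvalue N 1 \<cdot>\<^sub>v v"
    using N by (auto simp: eigenvalue_def eigenvector_def)
  then have "ord_eigenvalue N 1 * scalar_prod v v \<le> c * scalar_prod v v" using le[of v] by simp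
  then show ?thesis using scalar_prod_self_pos[OF v(1,2)] by simp
qed

section \<open>Matrix algebra under \<open>to_mat\<close>\<close>

lemma dim_to_mat [simp]:
  "dim_row (to_mat (M :: 'a ^ 'm::{finite,linorder} ^ 'n::{finite,linorder})) = CARD('n)"
  "dim_col (to_mat (M :: 'a ^ 'm::{finite,linorder} ^ 'n::{finite,linorder})) = CARD('m)"
  by (simp_all add: to_mat_def)

lemma to_mat_mult:
  fixes A :: "real ^ 'm::{finite,linorder} ^ 'n::{finite,linorder}"
    and B :: "real ^ 'l::{finite,linorder} ^ 'm::{finite,linorder}"
  shows "to_mat (A ** B) = to_mat A * to_mat B"
proof (rule eq_matI)
  fix i j assume "i < dim_row (to_mat A * to_mat B)" "j < dim_col (to_mat A * to_mat B)"
  then show "to_mat (A ** B) $$ (i, j) = (to_mat A * to_mat B) $$ (i, j)"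
    using sum_idx[of "\<lambda>x. A $ idx i $ x * B $ x $ idx j"]
    by (simp add: to_mat_def scalar_prod_def matrix_matrix_mult_def)
qed auto

lemma to_mat_add: "to_mat (A + B) = to_mat A + to_mat B"
  by (intro eq_matI) (auto simp: to_mat_def)

lemma to_mat_transpose: "to_mat (transpose A) = (to_mat A)\<^sup>T"
  by (intro eq_matI) (auto simp: to_mat_def Finite_Cartesian_Product.transpose_def)

lemma to_mat_one:
  "to_mat (mat 1 :: real ^ 'n::{finite,linorder} ^ 'n::{finite,linorder}) = 1\<^sub>m CARD('n)"
  by (intro eq_matI) (auto simp: to_mat_def Finite_Cartesian_Product.mat_def idx_eq_iff)

lemma matrix_transpose_add: "transpose (A + B) = transpose A + transpose B"
  for A B :: "'a::plus ^ 'm ^ 'n"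
  by (simp add: Finite_Cartesian_Product.transpose_def Finite_Cartesian_Product.vec_eq_iff)

lemma matrix_transpose_diff: "transpose (A - B) = transpose A - transpose B"
  for A B :: "'a::minus ^ 'm ^ 'n"
  by (simp add: Finite_Cartesian_Product.transpose_def Finite_Cartesian_Product.vec_eq_iff)

lemma sym_pos_def_inverse:
  assumes "sym_pos_def Q"
  shows "Q ** matrix_inv Q = mat 1" "matrix_inv Q ** Q = mat 1" "transpose (matrix_inv Q) = matrix_inv Q"
proof -
  have "x = 0" if "Q *v x = 0" for x
    using assms that by (force simp: sym_pos_def_def)
  then have inv: "invertible Q"
    by (metis invertible_left_inverse matrix_left_invertible_ker)
  then show 1: "Q ** matrix_inv Q = mat 1" and "matrix_inv Q ** Q = mat 1"
    unfolding invertible_def matrix_inv_def by (metis (mono_tags, lifting) someI_ex)+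
  have "transpose (matrix_inv Q) ** Q = mat 1"
    using assms 1 by (metis matrix_transpose_mul sym_pos_def_def transpose_mat)
  then have "transpose (matrix_inv Q) ** (Q ** matrix_inv Q) = matrix_inv Q"
    by (simp add: matrix_mul_assoc)
  then show "transpose (matrix_inv Q) = matrix_inv Q" using 1 by simp
qed

section \<open>Calculus of the quadratic forms of additive compounds\<close>

text \<open>For a fixed w this is a real number, so semidefinite inequalities between compounds
  become inequalities that linear arithmetic can combine.\<close>

definition quad_compound :: "nat \<Rightarrow> real Matrix.vec \<Rightarrow> real ^ 'n::{finite,linorder} ^ 'n::{finite,linorder} \<Rightarrow> real" where
  "quad_compound k w M = scalar_prod w (add_compound k (to_mat M) *\<^sub>v w)"

lemma quad_compound_add:
  fixes X Y :: "real ^ 'n::{finite,linorder} ^ 'n::{finite,linorder}"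
  assumes w: "w \<in> carrier_vec (CARD('n) choose k)"
  shows "quad_compound k w (X + Y) = quad_compound k w X + quad_compound k w Y"
proof -
  have "add_compound k (to_mat (X + Y)) = add_compound k (to_mat X) + add_compound k (to_mat Y)"
    unfolding to_mat_add by (rule add_compound_add[of _ "CARD('n)"]) auto
  moreover have "add_compound k (to_mat X) *\<^sub>v w \<in> carrier_vec (CARD('n) choose k)"
    "add_compound k (to_mat Y) *\<^sub>v w \<in> carrier_vec (CARD('n) choose k)"
    using mult_mat_vec_carrier[OF _ w] add_compound_carrier[OF to_mat_carrier] by auto
  ultimately show ?thesis using w
      add_mult_distrib_mat_vec[OF add_compound_carrier[OF to_mat_carrier[of X], of k]
        add_compound_carrier[OF to_mat_carrier[of Y], of k] w]
    by (simp add: quad_compound_def scalar_prod_add_distrib[of _ "CARD('n) choose k"])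
qed

lemma quad_compound_transpose:
  fixes X :: "real ^ 'n::{finite,linorder} ^ 'n::{finite,linorder}"
  assumes w: "w \<in> carrier_vec (CARD('n) choose k)"
  shows "quad_compound k w (transpose X) = quad_compound k w X"
proof -
  have X: "add_compound k (to_mat X) \<in> carrier_mat (CARD('n) choose k) (CARD('n) choose k)"
    by (rule add_compound_carrier[OF to_mat_carrier])
  have "add_compound k (to_mat (transpose X)) = (add_compound k (to_mat X))\<^sup>T"
    unfolding to_mat_transpose by (rule add_compound_transpose[of _ "CARD('n)"]) auto
  then have "quad_compound k w (transpose X) = scalar_prod ((add_compound k (to_mat X))\<^sup>T *\<^sub>v w) w"
    unfolding quad_compound_def using mult_mat_vec_carrier[OF transpose_carrier_mat[THEN iffD2, OF X] w]
    by (simp add: comm_scalar_prod[OF w])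
  also have "\<dots> = quad_compound k w X"
    unfolding quad_compound_def by (rule transpose_vec_mult_scalar[OF X w w])
  finally show ?thesis .
qed

lemma quad_compound_minus:
  fixes X :: "real ^ 'n::{finite,linorder} ^ 'n::{finite,linorder}"
  assumes w: "w \<in> carrier_vec (CARD('n) choose k)"
  shows "quad_compound k w (- X) = - quad_compound k w X"
  using quad_compound_add[OF w, of X "- X"] quad_compound_add[OF w, of "0 :: real ^ 'n::{finite,linorder} ^ 'n::{finite,linorder}" 0] by simp

text \<open>The eigenvalue estimate bounds forms only from above, so it is applied to -G G^T, whose
  eigenvalues are all nonpositive.\<close>

lemma quad_compound_gram:
  fixes G :: "real ^ 'm ^ 'n::{finite,linorder}"
  assumes w: "w \<in> carrier_vec (CARD('n) choose k)" and k: "k \<le> CARD('n)"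
  shows "quad_compound k w (G ** transpose G) \<ge> 0"
proof -
  let ?S = "- (G ** transpose G)"
  have sym: "transpose ?S = ?S"
  proof -
    have "transpose (- X) = - transpose X" for X :: "real ^ 'n::{finite,linorder} ^ 'n::{finite,linorder}"
      by (simp add: Finite_Cartesian_Product.transpose_def Finite_Cartesian_Product.vec_eq_iff)
    then show ?thesis by (simp add: matrix_transpose_mul)
  qed
  have "v \<bullet> (?S *v v) \<le> 0" for v
  proof -
    have "v \<bullet> ((G ** transpose G) *v v) = (transpose G *v v) \<bullet> (transpose G *v v)"
    proof -
      have "v \<bullet> (G *v (transpose G *v v)) = (transpose G *v v) \<bullet> (transpose G *v v)"
        by (simp add: transpose_matrix_vector dot_lmul_matrix)
      then show ?thesis by (simp add: matrix_vector_mul_assoc[symmetric] transpose_matrix_vector)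
    qed
    moreover have "?S *v v = - ((G ** transpose G) *v v)"
      by (simp add: matrix_vector_mult_def Finite_Cartesian_Product.vec_eq_iff sum_negf)
    ultimately show ?thesis by simp
  qed
  then have "(\<Sum>i=1..k. ord_eigenvalue (to_mat ?S) i) \<le> 0" by (rule sum_ord_eigenvalue_nonpos[OF sym k])
  moreover have "scalar_prod w w \<ge> 0" by (auto simp: scalar_prod_def intro: sum_nonneg)
  ultimately have "quad_compound k w ?S \<le> 0"
    unfolding quad_compound_def using add_compound_quadratic_le[OF sym k w]
    by (meson mult_nonneg_nonpos2 order_trans)
  then show ?thesis by (simp add: quad_compound_minus[OF w])
qed

section \<open>The Jacobian of the Lurie system and Gronwall's inequality\<close>

text \<open>The joint derivative is only relative to t >= 0, which at t = 0 is one-sided. Restricted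
  to the slice {t} x R^q and composed with y -> (t, y), it is a full derivative in y.\<close>

lemma C1_on_differentiable:
  assumes C1: "C1_on ({0..} \<times> UNIV) (\<lambda>(t, y). \<Phi> t y)" and t: "t \<ge> (0 :: real)"
  shows "\<Phi> t differentiable (at y)"
proof -
  obtain D where "((\<lambda>(t, y). \<Phi> t y) has_derivative blinfun_apply D) (at (t, y) within {0..} \<times> UNIV)"
    using C1 t by (force simp: C1_on_def)
  then have "((\<lambda>(t, y). \<Phi> t y) has_derivative blinfun_apply D) (at (t, y) within Pair t ` UNIV)"
    by (rule has_derivative_subset) (use t in auto)
  with has_derivative_Pair[OF has_derivative_const[of t] has_derivative_ident]
  have "((\<lambda>y. case (t, y) of (t, y) \<Rightarrow> \<Phi> t y) has_derivative (\<lambda>h. blinfun_apply D (0, h))) (at y)"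
    by (rule has_derivative_in_compose)
  then show ?thesis by (auto simp: differentiable_def)
qed

lemma jacobian_lurie:
  fixes \<Phi> :: "real \<Rightarrow> real ^ 'q \<Rightarrow> real ^ 'm"
  assumes "\<Phi> t differentiable (at (C *v x))"
  shows "jacobian (lurie A B C \<Phi> t) (at x) = lurie_jacobian A B C \<Phi> t x"
proof -
  let ?J = "jacobian (\<Phi> t) (at (C *v x))"
  have "(\<Phi> t has_derivative (\<lambda>h. ?J *v h)) (at (C *v x))"
    using assms jacobian_works by blast
  with bounded_linear.has_derivative[OF matrix_vector_mul_bounded_linear has_derivative_ident]
  have \<Phi>: "((\<lambda>x. \<Phi> t (C *v x)) has_derivative (\<lambda>h. ?J *v (C *v h))) (at x)"
    by (rule has_derivative_compose)
  have "(lurie A B C \<Phi> t has_derivative (\<lambda>h. A *v h - B *v (?J *v (C *v h)))) (at x)"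
    unfolding lurie_def
    by (intro has_derivative_diff bounded_linear.has_derivative[OF matrix_vector_mul_bounded_linear] \<Phi> has_derivative_ident)
  moreover have "(\<lambda>h. A *v h - B *v (?J *v (C *v h))) = (*v) (lurie_jacobian A B C \<Phi> t x)"
    by (simp add: lurie_jacobian_def fun_eq_iff matrix_vector_mult_diff_rdistrib matrix_vector_mul_assoc
        matrix_mul_assoc)
  ultimately have "frechet_derivative (lurie A B C \<Phi> t) (at x) = (*v) (lurie_jacobian A B C \<Phi> t x)"
    by (metis frechet_derivative_at)
  then show ?thesis by (simp add: jacobian_def matrix_of_matrix_vector_mul)
qed

text \<open>With the integrating factor exp(c (t - s)) the function becomes nonincreasing.\<close>

lemma gronwall_nonpos:
  fixes g g' :: "real \<Rightarrow> real"
  assumes deriv: "\<And>t. t \<in> {s..T} \<Longrightarrow> (g has_real_derivative g' t) (at t within {s..T})"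
    and le: "\<And>t. t \<in> {s..T} \<Longrightarrow> g' t \<le> - c * g t" and t: "t \<in> {s..T}"
  shows "g t \<le> exp (- c * (t - s)) * g s"
proof (cases "s = t")
  case False
  then have st: "s < t" using t by simp
  define h where "h = (\<lambda>t. exp (c * (t - s)) * g t)"
  have h: "(h has_real_derivative exp (c * (u - s)) * (c * g u + g' u)) (at u within {s..T})"
    if "u \<in> {s..T}" for u
  proof -
    have "((\<lambda>t. exp (c * (t - s))) has_real_derivative exp (c * (u - s)) * c) (at u within {s..T})"
      by (auto intro!: derivative_eq_intros)
    from DERIV_mult[OF this deriv[OF that]] show ?thesis
      unfolding h_def by (simp add: algebra_simps)
  qed
  have "h t \<le> h s"
  \<comment> \<open>At the ends of the interval only one-sided derivatives are given, so two-sided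
    ones are used inside and continuity at the ends.\<close>
  proof (rule DERIV_nonpos_imp_decreasing_open[where f = h and a = s and b = t])
    show "s \<le> t" using st by simp
    show "\<exists>y. DERIV h u :> y \<and> y \<le> 0" if "s < u" "u < t" for u
    proof -
      have u: "u \<in> {s..T}" "at u within {s..T} = at u" using that t by (auto intro: at_within_Icc_at)
      then have "DERIV h u :> exp (c * (u - s)) * (c * g u + g' u)" using h[OF u(1)] by simp
      moreover have "exp (c * (u - s)) * (c * g u + g' u) \<le> 0"
        using le[OF u(1)] by (intro mult_nonneg_nonpos) auto
      ultimately show ?thesis by blast
    qed
    have "continuous_on {s..T} h" using h by (rule DERIV_continuous_on)
    then show "continuous_on {s..t} h" by (rule continuous_on_subset) (use t in auto)
  qed
  then have "exp (c * (t - s)) * g t \<le> g s" by (simp add: h_def)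
  then have "exp (- c * (t - s)) * (exp (c * (t - s)) * g t) \<le> exp (- c * (t - s)) * g s"
    by (intro mult_left_mono) auto
  then show ?thesis by (simp add: mult.assoc[symmetric] exp_add[symmetric])
qed simp

section \<open>The Lurie system\<close>

text \<open>The form of the linear matrix inequality is evaluated at v = H^-1 w. Since H is
  symmetric, H v = w turns each outer factor H into w: the first two terms both become w^T H a H^-1
  w, and H m H becomes m. Applied with H = Q^(k), where H H = P^(k).\<close>

lemma lmi_congruence:
  fixes H :: "real Matrix.mat"
  assumes H: "H \<in> carrier_mat N N" and Hi: "Hi \<in> carrier_mat N N"
    and inv: "H * Hi = 1\<^sub>m N" and sym: "H\<^sup>T = H"
    and a: "a \<in> carrier_mat N N" and m: "m \<in> carrier_mat N N"
    and lmi: "neg_semidef (H * H * a + a\<^sup>T * (H * H) + \<eta> \<cdot>\<^sub>m (H * H) + H * m * H)"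
    and w: "w \<in> carrier_vec N"
  shows "2 * scalar_prod w ((H * a * Hi) *\<^sub>v w) + \<eta> * scalar_prod w w + scalar_prod w (m *\<^sub>v w) \<le> 0"
proof -
  define v where "v = Hi *\<^sub>v w"
  have v: "v \<in> carrier_vec N" using Hi w by (simp add: v_def)
  have Hv: "H *\<^sub>v v = w"
    using H Hi w inv by (simp add: v_def assoc_mult_mat_vec[of _ N N _ N, symmetric])
  have move: "scalar_prod v (H *\<^sub>v y) = scalar_prod w y" if "y \<in> carrier_vec N" for y
    using transpose_vec_mult_scalar[OF H that v] by (simp add: sym Hv)
  have c: "H * H * a \<in> carrier_mat N N" "a\<^sup>T * (H * H) \<in> carrier_mat N N"
    "\<eta> \<cdot>\<^sub>m (H * H) \<in> carrier_mat N N" "H * m * H \<in> carrier_mat N N"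
    using H a m by auto
  let ?L = "H * H * a + a\<^sup>T * (H * H) + \<eta> \<cdot>\<^sub>m (H * H) + H * m * H"
  have "?L *\<^sub>v v = H * H * a *\<^sub>v v + a\<^sup>T * (H * H) *\<^sub>v v + (\<eta> \<cdot>\<^sub>m (H * H)) *\<^sub>v v + H * m * H *\<^sub>v v"
    using c v mult_mat_vec_carrier[OF c(1) v] mult_mat_vec_carrier[OF c(2) v]
      mult_mat_vec_carrier[OF c(3) v] mult_mat_vec_carrier[OF c(4) v]
    by (simp add: add_mult_distrib_mat_vec[of _ N N] assoc_add_vec[of _ N])
  then have "scalar_prod v (?L *\<^sub>v v) = scalar_prod v (H * H * a *\<^sub>v v)
      + scalar_prod v (a\<^sup>T * (H * H) *\<^sub>v v) + scalar_prod v ((\<eta> \<cdot>\<^sub>m (H * H)) *\<^sub>v v)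
      + scalar_prod v (H * m * H *\<^sub>v v)"
    using mult_mat_vec_carrier[OF c(1) v] mult_mat_vec_carrier[OF c(2) v]
      mult_mat_vec_carrier[OF c(3) v] mult_mat_vec_carrier[OF c(4) v] v
    by (simp add: scalar_prod_add_distrib[of _ N])
  moreover have Haw: "(H * a * Hi) *\<^sub>v w = H *\<^sub>v (a *\<^sub>v v)"
    using H a Hi w by (simp add: v_def assoc_mult_mat_vec[of _ N N _ N])
  moreover have "scalar_prod v (H * H * a *\<^sub>v v) = scalar_prod w (H *\<^sub>v (a *\<^sub>v v))"
    using H a v by (simp add: assoc_mult_mat_vec[of _ N N _ N] move)
  moreover have "scalar_prod v (a\<^sup>T * (H * H) *\<^sub>v v) = scalar_prod w (H *\<^sub>v (a *\<^sub>v v))"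
  proof -
    have av: "a *\<^sub>v v \<in> carrier_vec N" and Hw: "H *\<^sub>v w \<in> carrier_vec N" using a v H w by auto
    have "scalar_prod v (a\<^sup>T * (H * H) *\<^sub>v v) = scalar_prod v (a\<^sup>T *\<^sub>v (H *\<^sub>v w))"
      using a v H Hv by (simp add: assoc_mult_mat_vec[of _ N N _ N])
    also have "\<dots> = scalar_prod (a\<^sup>T *\<^sub>v (H *\<^sub>v w)) v"
      using a Hw v by (intro comm_scalar_prod) auto
    also have "\<dots> = scalar_prod (H *\<^sub>v w) (a *\<^sub>v v)" by (rule transpose_vec_mult_scalar[OF a v Hw])
    also have "\<dots> = scalar_prod w (H *\<^sub>v (a *\<^sub>v v))"
      using transpose_vec_mult_scalar[OF H av w] by (simp add: sym)
    finally show ?thesis .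
  qed
  moreover have "scalar_prod v ((\<eta> \<cdot>\<^sub>m (H * H)) *\<^sub>v v) = \<eta> * scalar_prod w w"
  proof -
    have HHv: "H * H *\<^sub>v v = H *\<^sub>v w" using H v Hv by (simp add: assoc_mult_mat_vec[of _ N N _ N])
    have "(\<eta> \<cdot>\<^sub>m K) *\<^sub>v v = \<eta> \<cdot>\<^sub>v (K *\<^sub>v v)" if "K \<in> carrier_mat N N" for K
      using that v by (intro eq_vecI) auto
    from this[OF mult_carrier_mat[OF H H]]
    have smult: "(\<eta> \<cdot>\<^sub>m (H * H)) *\<^sub>v v = \<eta> \<cdot>\<^sub>v (H * H *\<^sub>v v)" .
    show ?thesis unfolding smult HHv using H v w move[OF w] by simp
  qed
  moreover have "scalar_prod v (H * m * H *\<^sub>v v) = scalar_prod w (m *\<^sub>v w)"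
    using H m v w by (simp add: assoc_mult_mat_vec[of _ N N _ N] Hv move)
  moreover have "scalar_prod v (?L *\<^sub>v v) \<le> 0"
    using lmi v H m by (auto simp: neg_semidef_def)
  ultimately show ?thesis by simp
qed

text \<open>A right inverse of a square matrix is its unique two-sided inverse. This lets the
  inverse inside \<open>matrix_measure2\<close> be replaced by the compound of Q^-1.\<close>

lemma mat_inverse_eq:
  fixes H :: "real Matrix.mat"
  assumes H: "H \<in> carrier_mat N N" and Hi: "Hi \<in> carrier_mat N N" and inv: "H * Hi = 1\<^sub>m N"
  shows "mat_inverse H = Some Hi"
proof (cases "mat_inverse H")
  case None
  have "Hi * H = 1\<^sub>m N" using mat_mult_left_right_inverse[OF H Hi inv] .
  then have "H \<in> Units (ring_mat TYPE(real) N ())"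
    using H Hi inv by (auto simp: Units_def ring_mat_def)
  then show ?thesis using mat_inverse(1)[OF H None, where b = "()"] by simp
next
  case (Some B)
  then have B: "B * H = 1\<^sub>m N" "B \<in> carrier_mat N N" using mat_inverse(2)[OF H Some] by auto
  have "B = B * (H * Hi)" using B inv by simp
  also have "\<dots> = Hi" using B H Hi by (simp add: assoc_mult_mat[of _ N N _ N _ N, symmetric])
  finally show ?thesis using Some by simp
qed

lemma matrix_add_rdistrib:
  fixes A B :: "'a::semiring_1 ^ 'm ^ 'n" and C :: "'a ^ 'l ^ 'm"
  shows "(A + B) ** C = A ** C + B ** C"
  by (simp add: matrix_matrix_mult_def Finite_Cartesian_Product.vec_eq_iff sum.distrib distrib_right)

lemma matrix_diff_ldistrib:
  fixes A :: "'a::ring_1 ^ 'm ^ 'n" and B C :: "'a ^ 'l ^ 'm"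
  shows "A ** (B - C) = A ** B - A ** C"
  by (simp add: matrix_matrix_mult_def Finite_Cartesian_Product.vec_eq_iff sum_subtractf right_diff_distrib)

lemma matrix_diff_rdistrib:
  fixes A B :: "'a::ring_1 ^ 'm ^ 'n" and C :: "'a ^ 'l ^ 'm"
  shows "(A - B) ** C = A ** C - B ** C"
  by (simp add: matrix_matrix_mult_def Finite_Cartesian_Product.vec_eq_iff sum_subtractf left_diff_distrib)

text \<open>In the square of U + V^T the mixed terms U V and V^T U^T are exactly those that the
  symmetric part of -U V contributes with opposite sign.\<close>

lemma complete_square:
  fixes U :: "real ^ 'm ^ 'n" and V :: "real ^ 'n ^ 'm"
  shows "(X - U ** V) + transpose (X - U ** V) + (U + transpose V) ** transpose (U + transpose V)
    = X + transpose X + U ** transpose U + transpose V ** V"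
  by (simp add: matrix_transpose_add matrix_transpose_diff matrix_transpose_mul matrix_add_ldistrib
      matrix_add_rdistrib)

text \<open>The form takes equal values on a matrix and its transpose, hence the factors 2; the
  square on the left of \<open>complete_square\<close> has a nonnegative form and is
  dropped.\<close>

lemma quad_compound_coupling_le:
  fixes X :: "real ^ 'n::{finite,linorder} ^ 'n::{finite,linorder}"
    and U :: "real ^ 'm ^ 'n::{finite,linorder}" and V :: "real ^ 'n::{finite,linorder} ^ 'm"
  assumes w: "w \<in> carrier_vec (CARD('n) choose k)" and k: "k \<le> CARD('n)"
  shows "2 * quad_compound k w (X - U ** V)
    \<le> 2 * quad_compound k w X + quad_compound k w (U ** transpose U) + quad_compound k w (transpose V ** V)"
proof -
  note add = quad_compound_add[OF w] and tr = quad_compound_transpose[OF w]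
  have "2 * quad_compound k w (X - U ** V)
      + quad_compound k w ((U + transpose V) ** transpose (U + transpose V))
    = 2 * quad_compound k w X + quad_compound k w (U ** transpose U) + quad_compound k w (transpose V ** V)"
    using arg_cong[OF complete_square[of X U V], of "quad_compound k w"] by (simp only: add tr)
  then show ?thesis using quad_compound_gram[OF w k, of "U + transpose V"] by linarith
qed

section \<open>From a bound on the scaled additive compound to k-contraction\<close>

lemma scalar_prod_col_deriv:
  assumes Y: "mat_deriv N m Y Y' (at t within S)" and m: "0 < m"
  shows "((\<lambda>t. scalar_prod (col (Y t) 0) (col (Y t) 0)) has_real_derivative
    2 * scalar_prod (col (Y t) 0) (col Y' 0)) (at t within S)"
proof -
  have c: "Y' \<in> carrier_mat N m" "\<And>t. Y t \<in> carrier_mat N m" using Y by (auto simp: mat_deriv_def)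
  note dim = carrier_matD[OF c(1)] carrier_matD[OF c(2)]
  have "((\<lambda>t. \<Sum>i = 0..<N. Y t $$ (i, 0) * Y t $$ (i, 0)) has_real_derivative
      (\<Sum>i = 0..<N. 2 * (Y t $$ (i, 0) * Y' $$ (i, 0)))) (at t within S)"
  proof (rule DERIV_sum)
    fix i assume "i \<in> {0..<N}"
    then have "((\<lambda>t. Y t $$ (i, 0)) has_real_derivative Y' $$ (i, 0)) (at t within S)"
      using Y m by (simp add: mat_deriv_def)
    from DERIV_mult[OF this this]
    show "((\<lambda>t. Y t $$ (i, 0) * Y t $$ (i, 0)) has_real_derivative 2 * (Y t $$ (i, 0) * Y' $$ (i, 0))) (at t within S)"
      by (simp add: mult_ac)
  qed
  then show ?thesis using m by (simp add: scalar_prod_def dim sum_distrib_left)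
qed

lemma cols_to_mat_deriv:
  fixes \<delta> :: "nat \<Rightarrow> real \<Rightarrow> real ^ 'n::{finite,linorder}"
  assumes "\<And>j. j < k \<Longrightarrow> (\<delta> j has_vector_derivative (M *v \<delta> j t)) (at t within S)"
  shows "mat_deriv CARD('n) k (\<lambda>t. cols_to_mat k (\<lambda>j. \<delta> j t)) (to_mat M * cols_to_mat k (\<lambda>j. \<delta> j t)) (at t within S)"
proof -
  have "((\<lambda>t. \<delta> j t $ idx i) has_real_derivative
      (\<Sum>l = 0..<CARD('n). M $ idx i $ idx l * \<delta> j t $ idx l)) (at t within S)"
    if "i < CARD('n)" "j < k" for i j
    using bounded_linear.has_vector_derivative[OF bounded_linear_vec_nth[of "idx i"] assms[OF that(2)]]
      sum_idx[of "\<lambda>x. M $ idx i $ x * \<delta> j t $ x"]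
    by (simp add: has_real_derivative_iff_has_vector_derivative matrix_vector_mult_def)
  then show ?thesis by (auto simp: mat_deriv_def cols_to_mat_def to_mat_def scalar_prod_def)
qed

text \<open>Gronwall's inequality is applied to g = |H X^(k)|^2, which unlike the norm is
  differentiable also where it vanishes. In the coordinate w = H X^(k) its derivative is 2 w^T H
  J^[k] H^-1 w <= -2 eta g; the square root then halves the rate.\<close>

lemma k_contractiveI:
  fixes f :: "real \<Rightarrow> real ^ 'n::{finite,linorder} \<Rightarrow> real ^ 'n::{finite,linorder}"
    and k :: nat
  defines "N \<equiv> CARD('n) choose k"
  assumes H: "H \<in> carrier_mat N N" and Hi: "Hi \<in> carrier_mat N N" and inv: "Hi * H = 1\<^sub>m N"
    and \<eta>: "\<eta> > 0"
    and bound: "\<And>t x w. 0 \<le> t \<Longrightarrow> w \<in> carrier_vec N \<Longrightarrow>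
      scalar_prod w ((H * add_compound k (to_mat (jacobian (f t) (at x))) * Hi) *\<^sub>v w) \<le> - \<eta> * scalar_prod w w"
  shows "k_contractive k \<eta> (scaled_norm2 H) UNIV f"
  unfolding k_contractive_def Let_def
proof (intro conjI allI impI ballI)
  fix s T t :: real and x and \<delta> :: "nat \<Rightarrow> real \<Rightarrow> real ^ 'n::{finite,linorder}"
  assume s: "0 \<le> s" and "solution_on f UNIV s T x" and t: "t \<in> {s..T}"
    and sol: "\<forall>j<k. solution_on (\<lambda>t v. jacobian (f t) (at (x t)) *v v) UNIV s T (\<delta> j)"
  define X where "X = (\<lambda>t. cols_to_mat k (\<lambda>j. \<delta> j t))"
  define J where "J = (\<lambda>t. to_mat (jacobian (f t) (at (x t))))"
  define Y where "Y = (\<lambda>t. H * compound k (X t))"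
  define g where "g = (\<lambda>t. scalar_prod (col (Y t) 0) (col (Y t) 0))"
  have Xc: "X u \<in> carrier_mat CARD('n) k" for u by (simp add: X_def cols_to_mat_def)
  have Jc: "J u \<in> carrier_mat CARD('n) CARD('n)" for u by (simp add: J_def)
  have Ck: "compound k (X u) \<in> carrier_mat N 1" for u
    using compound_carrier[OF Xc, of k u] by (simp add: N_def)
  have Ac: "add_compound k (J u) \<in> carrier_mat N N" for u
    unfolding N_def by (rule add_compound_carrier[OF Jc])
  have norm: "scaled_norm2 H (col (compound k (X u)) 0) = sqrt (g u)" for u
    using col_mult2[OF H Ck, of 0 u] by (simp add: scaled_norm2_def norm2_def g_def Y_def)
  have "g t \<le> exp (- (2 * \<eta>) * (t - s)) * g s"
  proof (rule gronwall_nonpos[OF _ _ t])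
    fix u assume u: "u \<in> {s..T}"
    let ?Y' = "H * (add_compound k (J u) * compound k (X u))"
    have "mat_deriv CARD('n) k X (J u * X u) (at u within {s..T})"
      unfolding X_def J_def using sol u by (intro cols_to_mat_deriv) (auto simp: solution_on_def)
    from compound_mat_deriv[OF this, of k]
    have "mat_deriv N 1 (\<lambda>u. compound k (X u)) (add_compound k (J u) * compound k (X u)) (at u within {s..T})"
      by (simp add: compound_deriv_linear[OF Jc Xc] N_def)
    from mat_deriv_mult_left[OF H this]
    have Y: "mat_deriv N 1 Y ?Y' (at u within {s..T})" by (simp add: Y_def)
    show "(g has_real_derivative 2 * scalar_prod (col (Y u) 0) (col ?Y' 0)) (at u within {s..T})"
      unfolding g_def by (rule scalar_prod_col_deriv[OF Y]) simp
    define z where "z = col (compound k (X u)) 0"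
    define w where "w = H *\<^sub>v z"
    have z: "z \<in> carrier_vec N" using carrier_matD[OF Ck[of u]] by (auto simp: z_def intro!: carrier_vecI)
    then have w: "w \<in> carrier_vec N" using H by (auto simp: w_def)
    have Yw: "col (Y u) 0 = w" using col_mult2[OF H Ck, of 0 u] by (simp add: Y_def w_def z_def)
    have "Hi *\<^sub>v w = z"
      using Hi H z inv by (simp add: w_def assoc_mult_mat_vec[of _ N N _ N, symmetric])
    then have "(H * add_compound k (J u) * Hi) *\<^sub>v w = H *\<^sub>v (add_compound k (J u) *\<^sub>v z)"
      using H Hi Ac[of u] w z by (simp add: assoc_mult_mat_vec[of _ N N _ N])
    also have "\<dots> = col ?Y' 0"
      using col_mult2[OF H mult_carrier_mat[OF Ac Ck], of 0 u u] col_mult2[OF Ac Ck, of 0 u u] by (simp add: z_def)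
    finally have Y': "col ?Y' 0 = (H * add_compound k (J u) * Hi) *\<^sub>v w" ..
    show "2 * scalar_prod (col (Y u) 0) (col ?Y' 0) \<le> - (2 * \<eta>) * g u"
      unfolding g_def Yw Y' using bound[OF _ w, of u "x u"] u s by (simp add: J_def)
  qed
  also have "\<dots> = (exp (- \<eta> * (t - s)))\<^sup>2 * g s"
    by (simp add: power2_eq_square exp_add[symmetric] algebra_simps)
  finally have "sqrt (g t) \<le> sqrt ((exp (- \<eta> * (t - s)))\<^sup>2 * g s)" by simp
  then show "scaled_norm2 H (col (compound k (cols_to_mat k (\<lambda>j. \<delta> j t))) 0)
    \<le> exp (- \<eta> * (t - s)) * scaled_norm2 H (col (compound k (cols_to_mat k (\<lambda>j. \<delta> j s))) 0)"
    using norm unfolding X_def by (simp add: real_sqrt_mult)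
qed (rule \<eta>)

theorem theorem1:
  fixes A P Q :: "real ^ 'n::{finite,linorder} ^ 'n::{finite,linorder}"
    and B :: "real ^ 'm ^ 'n::{finite,linorder}"
    and C :: "real ^ 'n::{finite,linorder} ^ 'q"
    and \<Phi> :: "real \<Rightarrow> real ^ 'q \<Rightarrow> real ^ 'm"
    and k :: nat
    and \<eta>1 \<eta>2 :: real
  defines "J\<Phi> \<equiv> \<lambda>t y. jacobian (\<Phi> t) (at y)"
    and "Pk \<equiv> compound k (to_mat P)"
    and "Qk \<equiv> compound k (to_mat Q)"
    and "Ak \<equiv> add_compound k (to_mat A)"
    and "Qi \<equiv> matrix_inv Q"
  assumes \<Phi>_C1: "C1_on ({0..} \<times> UNIV) (\<lambda>(t, y). \<Phi> t y)"
    and k: "1 \<le> k" "k \<le> CARD('n)"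
    and Q: "sym_pos_def Q" and P: "P = Q ** Q"
    and LMI:
      "neg_semidef
         (Pk * Ak + Ak\<^sup>T * Pk + \<eta>1 \<cdot>\<^sub>m Pk
          + Qk * (add_compound k (to_mat (Q ** B ** transpose B ** Q))
                  + add_compound k (to_mat (Qi ** transpose C ** C ** Qi))) * Qk)"
    and cond:
      "(\<forall>t\<ge>0. \<forall>y. (\<Sum>i=1..k. ord_eigenvalue
          (to_mat (Qi ** transpose C ** (transpose (J\<Phi> t y) ** J\<Phi> t y - mat 1) ** C ** Qi)) i) \<le> - \<eta>2) \<or>
       (\<forall>t\<ge>0. \<forall>y. (\<Sum>i=1..k. ord_eigenvalue
          (to_mat (Q ** B ** (J\<Phi> t y ** transpose (J\<Phi> t y) - mat 1) ** transpose B ** Q)) i) \<le> - \<eta>2)"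
  shows "(\<forall>t\<ge>0. \<forall>x. matrix_measure2 Qk (add_compound k (to_mat (lurie_jacobian A B C \<Phi> t x)))
            \<le> - (\<eta>1 + \<eta>2) / 2) \<and>
         (\<eta>1 + \<eta>2 > 0 \<longrightarrow>
            k_contractive k ((\<eta>1 + \<eta>2) / 2) (scaled_norm2 Qk) UNIV (lurie A B C \<Phi>))"
proof -
  define N where "N = CARD('n) choose k"
  define Qki where "Qki = compound k (to_mat Qi)"
  define M1 where "M1 = Q ** B ** transpose B ** Q"
  define M2 where "M2 = Qi ** transpose C ** C ** Qi"
  have QQi: "Q ** Qi = mat 1" "Qi ** Q = mat 1" and Qi_sym: "transpose Qi = Qi"
    using sym_pos_def_inverse[OF Q] by (simp_all add: Qi_def)
  have Q_sym: "transpose Q = Q" using Q by (simp add: sym_pos_def_def)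
  have Qk: "Qk \<in> carrier_mat N N" and Qki: "Qki \<in> carrier_mat N N"
    by (simp_all add: Qk_def Qki_def N_def)
  have compound_inv: "compound k (to_mat R) * compound k (to_mat S) = 1\<^sub>m N"
    if "R ** S = mat 1" for R S :: "real ^ 'n::{finite,linorder} ^ 'n::{finite,linorder}"
    using arg_cong[OF that, of to_mat]
      compound_mult[OF to_mat_carrier[of R] to_mat_carrier[of S], of k]
    by (simp add: to_mat_mult to_mat_one compound_one N_def)
  have inv: "Qk * Qki = 1\<^sub>m N" "Qki * Qk = 1\<^sub>m N"
    unfolding Qk_def Qki_def using compound_inv QQi by auto
  have Qk_sym: "Qk\<^sup>T = Qk"
    unfolding Qk_def
    using compound_transpose[OF to_mat_carrier[of Q], of k] Q_sym by (simp add: to_mat_transpose[symmetric])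
  have Pk: "Pk = Qk * Qk"
    unfolding Pk_def Qk_def P by (simp add: to_mat_mult compound_mult[of _ "CARD('n)" "CARD('n)" _ "CARD('n)"])
  have Ak: "Ak \<in> carrier_mat N N"
    using add_compound_carrier[OF to_mat_carrier[of A], of k] by (simp add: Ak_def N_def)
  have scaled: "add_compound k (to_mat (Q ** X ** Qi)) = Qk * add_compound k (to_mat X) * Qki"
    for X :: "real ^ 'n::{finite,linorder} ^ 'n::{finite,linorder}"
    unfolding Qk_def Qki_def to_mat_mult
    by (rule add_compound_similar[of _ "CARD('n)"])
      (simp_all add: to_mat_mult[symmetric] QQi to_mat_one)
  have quad_le: "2 * quad_compound k w (Q ** lurie_jacobian A B C \<Phi> t x ** Qi)
      \<le> - (\<eta>1 + \<eta>2) * scalar_prod w w" if t: "t \<ge> 0" and w: "w \<in> carrier_vec N" for t x w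
  proof -
    let ?J = "J\<Phi> t (C *v x)" and ?X = "Q ** A ** Qi"
    note w' = w[unfolded N_def] and add = quad_compound_add[OF w[unfolded N_def]]
    have ww: "scalar_prod w w \<ge> 0" by (auto simp: scalar_prod_def intro: sum_nonneg)
    have M12: "add_compound k (to_mat M1) + add_compound k (to_mat M2) = add_compound k (to_mat (M1 + M2))"
      unfolding to_mat_add by (rule add_compound_add[symmetric, of _ "CARD('n)"]) auto
    have m: "add_compound k (to_mat (M1 + M2)) \<in> carrier_mat N N"
      using add_compound_carrier[OF to_mat_carrier[of "M1 + M2"], of k] by (simp add: N_def)
    have lmi': "neg_semidef (Qk * Qk * Ak + Ak\<^sup>T * (Qk * Qk) + \<eta>1 \<cdot>\<^sub>m (Qk * Qk)
        + Qk * add_compound k (to_mat (M1 + M2)) * Qk)"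
      unfolding M12[symmetric] using LMI unfolding Pk M1_def M2_def .
    have "2 * scalar_prod w ((Qk * Ak * Qki) *\<^sub>v w) + \<eta>1 * scalar_prod w w
        + scalar_prod w (add_compound k (to_mat (M1 + M2)) *\<^sub>v w) \<le> 0"
      by (rule lmi_congruence[OF Qk Qki inv(1) Qk_sym Ak m lmi' w])
    then have lmi: "2 * quad_compound k w ?X + \<eta>1 * scalar_prod w w
        + (quad_compound k w M1 + quad_compound k w M2) \<le> 0"
      unfolding add[symmetric] by (simp add: quad_compound_def scaled Ak_def)
    have lurie: "Q ** lurie_jacobian A B C \<Phi> t x ** Qi = ?X - Q ** B ** ?J ** C ** Qi"
      by (simp add: lurie_jacobian_def J\<Phi>_def matrix_diff_ldistrib matrix_diff_rdistrib matrix_mul_assoc)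
    \<comment> \<open>The common end of both cases: R is the matrix of the condition. The linear
      matrix inequality absorbs the terms with M1 and M2, and the eigenvalue sum bounds the form of
      R.\<close>
    have goal: ?thesis
      if "2 * quad_compound k w (Q ** lurie_jacobian A B C \<Phi> t x ** Qi)
          \<le> 2 * quad_compound k w ?X + quad_compound k w M1 + quad_compound k w M2 + quad_compound k w R"
        and R: "transpose R = R" "(\<Sum>i=1..k. ord_eigenvalue (to_mat R) i) \<le> - \<eta>2"
      for R :: "real ^ 'n::{finite,linorder} ^ 'n::{finite,linorder}"
    proof -
      have "quad_compound k w R \<le> (\<Sum>i=1..k. ord_eigenvalue (to_mat R) i) * scalar_prod w w"
        unfolding quad_compound_def by (rule add_compound_quadratic_le[OF R(1) k(2) w'])
      also have "\<dots> \<le> - \<eta>2 * scalar_prod w w" by (rule mult_right_mono[OF R(2) ww])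
      finally show ?thesis using that(1) lmi by (simp add: algebra_simps)
    qed
    from cond show ?thesis
    proof
      assume i: "\<forall>t\<ge>0. \<forall>y. (\<Sum>i=1..k. ord_eigenvalue
          (to_mat (Qi ** transpose C ** (transpose (J\<Phi> t y) ** J\<Phi> t y - mat 1) ** C ** Qi)) i) \<le> - \<eta>2"
      let ?R = "Qi ** transpose C ** (transpose ?J ** ?J - mat 1) ** C ** Qi"
      \<comment> \<open>U U^T is M1 itself, while J^T J = I + (J^T J - I) splits V^T V into M2 and
        R.\<close>
      let ?U = "Q ** B" and ?V = "?J ** C ** Qi"
      have U: "?U ** transpose ?U = M1"
        by (simp add: M1_def matrix_transpose_mul Q_sym matrix_mul_assoc)
      have V: "transpose ?V ** ?V = M2 + ?R"
        by (simp add: M2_def matrix_transpose_mul Qi_sym matrix_mul_assoc matrix_diff_ldistrib matrix_diff_rdistrib)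
      show ?thesis
      proof (rule goal[of ?R])
        show "2 * quad_compound k w (Q ** lurie_jacobian A B C \<Phi> t x ** Qi)
          \<le> 2 * quad_compound k w ?X + quad_compound k w M1 + quad_compound k w M2 + quad_compound k w ?R"
          using quad_compound_coupling_le[OF w' k(2), of ?X ?U ?V] unfolding U V add lurie
          by (simp add: matrix_mul_assoc)
        show "transpose ?R = ?R"
          by (simp add: matrix_transpose_mul Qi_sym matrix_transpose_diff matrix_mul_assoc)
        show "(\<Sum>i=1..k. ord_eigenvalue (to_mat ?R) i) \<le> - \<eta>2" using i t by blast
      qed
    next
      assume ii: "\<forall>t\<ge>0. \<forall>y. (\<Sum>i=1..k. ord_eigenvalue
          (to_mat (Q ** B ** (J\<Phi> t y ** transpose (J\<Phi> t y) - mat 1) ** transpose B ** Q)) i) \<le> - \<eta>2"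
      let ?R = "Q ** B ** (?J ** transpose ?J - mat 1) ** transpose B ** Q"
      \<comment> \<open>Now V^T V is M2 itself, and J J^T = I + (J J^T - I) splits U U^T into M1 and
        R.\<close>
      let ?U = "Q ** B ** ?J" and ?V = "C ** Qi"
      have U: "?U ** transpose ?U = M1 + ?R"
        by (simp add: M1_def matrix_transpose_mul Q_sym matrix_mul_assoc matrix_diff_ldistrib matrix_diff_rdistrib)
      have V: "transpose ?V ** ?V = M2"
        by (simp add: M2_def matrix_transpose_mul Qi_sym matrix_mul_assoc)
      show ?thesis
      proof (rule goal[of ?R])
        show "2 * quad_compound k w (Q ** lurie_jacobian A B C \<Phi> t x ** Qi)
          \<le> 2 * quad_compound k w ?X + quad_compound k w M1 + quad_compound k w M2 + quad_compound k w ?R"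
          using quad_compound_coupling_le[OF w' k(2), of ?X ?U ?V] unfolding U V add lurie
          by (simp add: matrix_mul_assoc)
        show "transpose ?R = ?R"
          by (simp add: matrix_transpose_mul Q_sym matrix_transpose_diff matrix_mul_assoc)
        show "(\<Sum>i=1..k. ord_eigenvalue (to_mat ?R) i) \<le> - \<eta>2" using ii t by blast
      qed
    qed
  qed
  show ?thesis
  proof (intro conjI allI impI)
    fix t :: real and x assume t: "t \<ge> 0"
    let ?Jk = "add_compound k (to_mat (lurie_jacobian A B C \<Phi> t x))"
    let ?N = "Qk * ?Jk * Qki"
    have Jk: "?Jk \<in> carrier_mat N N" unfolding N_def by (rule add_compound_carrier[OF to_mat_carrier])
    have Nc: "?N \<in> carrier_mat N N" by (rule mult_carrier_mat[OF mult_carrier_mat[OF Qk Jk] Qki])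
    have "ord_eigenvalue (?N + ?N\<^sup>T) 1 \<le> - (\<eta>1 + \<eta>2)"
    proof (rule ord_eigenvalue_first_le)
      show "?N + ?N\<^sup>T \<in> carrier_mat N N" using Nc by simp
      show "(?N + ?N\<^sup>T)\<^sup>T = ?N + ?N\<^sup>T"
        using Nc by (simp add: transpose_add[of _ N N] comm_add_mat[of _ N N])
      \<comment> \<open>The bound k <= n makes the binomial coefficient positive, so the compound
        has eigenvalues at all.\<close>
      show "N > 0" using k by (simp add: N_def)
      fix w :: "real Matrix.vec" assume w: "w \<in> carrier_vec N"
      \<comment> \<open>A matrix and its transpose have the same form, so N + N^T doubles it; this
        matches the factor 2 in \<open>quad_le\<close>.\<close>
      have "scalar_prod w (?N\<^sup>T *\<^sub>v w) = scalar_prod w (?N *\<^sub>v w)"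
        using transpose_vec_mult_scalar[OF Nc w w] Nc w by (simp add: comm_scalar_prod[of w N])
      then have "scalar_prod w ((?N + ?N\<^sup>T) *\<^sub>v w) = 2 * scalar_prod w (?N *\<^sub>v w)"
        using Nc w add_mult_distrib_mat_vec[OF Nc _ w, of "?N\<^sup>T"]
          mult_mat_vec_carrier[OF Nc w] mult_mat_vec_carrier[of "?N\<^sup>T" N N w]
        by (simp add: scalar_prod_add_distrib[of _ N])
      then show "scalar_prod w ((?N + ?N\<^sup>T) *\<^sub>v w) \<le> - (\<eta>1 + \<eta>2) * scalar_prod w w"
        using quad_le[OF t w, of x] by (simp add: quad_compound_def scaled)
    qed
    then show "matrix_measure2 Qk ?Jk \<le> - (\<eta>1 + \<eta>2) / 2"
      by (simp add: matrix_measure2_def mat_inverse_eq[OF Qk Qki inv(1)] Let_def)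
  next
    assume pos: "\<eta>1 + \<eta>2 > 0"
    show "k_contractive k ((\<eta>1 + \<eta>2) / 2) (scaled_norm2 Qk) UNIV (lurie A B C \<Phi>)"
    proof (rule k_contractiveI)
      show "Qk \<in> carrier_mat (CARD('n) choose k) (CARD('n) choose k)"
        "Qki \<in> carrier_mat (CARD('n) choose k) (CARD('n) choose k)"
        "Qki * Qk = 1\<^sub>m (CARD('n) choose k)"
        using Qk Qki inv by (simp_all add: N_def)
      show "(\<eta>1 + \<eta>2) / 2 > 0" using pos by simp
      fix t :: real and x and w :: "real Matrix.vec"
      assume t: "0 \<le> t" and w: "w \<in> carrier_vec (CARD('n) choose k)"
      \<comment> \<open>Contraction is defined by the Jacobian of the vector field; continuous
        differentiability of the nonlinearity identifies it with the explicit
        \<open>lurie_jacobian\<close> of the estimate.\<close>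
      have "jacobian (lurie A B C \<Phi> t) (at x) = lurie_jacobian A B C \<Phi> t x"
        by (intro jacobian_lurie C1_on_differentiable \<Phi>_C1 t)
      moreover have "quad_compound k w (Q ** lurie_jacobian A B C \<Phi> t x ** Qi)
          \<le> - ((\<eta>1 + \<eta>2) / 2) * scalar_prod w w"
        using quad_le[OF t, of w x] w unfolding N_def by (simp add: field_simps)
      ultimately show "scalar_prod w ((Qk * add_compound k (to_mat (jacobian (lurie A B C \<Phi> t) (at x))) * Qki) *\<^sub>v w)
          \<le> - ((\<eta>1 + \<eta>2) / 2) * scalar_prod w w"
        by (simp only: quad_compound_def scaled)
    qed
  qed
qed

end
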